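(* Let $\mathcal{O}_0$ be a finite set of closed formulas of $\Omega$, let $\varphi$ be a closed formula of $\Omega$, let $\Gamma=\mathcal{O}_0\cup\{\varphi\}$, and let $\Delta_0$ be the set of all constants occurring in formulas of $\Gamma$. Then Proponent has a winning strategy in the game starting from the position $\mathcal{C}_0=(\mathcal{O}_0,\{\varphi\},\Delta_0)$ if and only if $\mathcal{O}_0\vDash_{Cas}\varphi$.
   Context: Language: $\Omega$ is a first-order intuitionistic language with predicate symbols and constants but no function symbols; connectives $\to,\wedge,\vee,\bot$ and quantifiers $\forall,\exists$; $\neg A$ abbreviates $A\to\bot$. Kripke frames are partially ordered sets of worlds together with an individual domain $\Delta_w$ at each world $w$, monotone along the order (the domains are considered part of the frame); a Kripke model adds an interpretation of constants and a monotone interpretation of atomic formulas, with the usual intuitionistic forcing clauses. For a class $X$ of frames, $T\vDash_X\varphi$ means: for every Kripke model based on a frame in $X$, if every formula of $T$ is true at every world of the model, then $\varphi$ is true at every world. $Cas$ (Casari's class) is the class of all Kripke frames on which Casari's formula $\forall x[(P[x]\to\forall xP[x])\to\forall xP[x]]\to\forall xP[x]$ is valid; equivalently, frames in which along every countable increasing sequence of worlds the individual domains are finite and eventually stabilize. The game. For a set of formulas $\Gamma$ and a set $\Delta$ of objects, $\mathcal{F}(\Gamma,\Delta)$ is the set of all formulas $P[c_1,\dots,c_n]$ where $P[x_1,\dots,x_n]$ is a subformula of some formula of $\Gamma$ whose free variables are among $x_1,\dots,x_n$ and $c_i\in\Delta$. A position is a triple $\mathcal{C}=(\mathcal{O},\mathcal{P},\Delta)$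 with $\mathcal{O},\mathcal{P}\subseteq\mathcal{F}(\Gamma,\Delta)$, where $\Gamma$ is fixed at the start of the game as $\mathcal{O}_0\cup\{\varphi\}$ for the starting position $(\mathcal{O}_0,\{\varphi\},\Delta_0)$, with $\Delta_0$ the set of constants occurring in $\Gamma$. Proponent moves by adding formulas of $\mathcal{F}(\Gamma,\Delta)$ to $\mathcal{P}$. Opponent moves by first extending $\Delta$ to some $\Delta'\supseteq\Delta$ (possibly $\Delta'=\Delta$; new elements may be arbitrary new objects) and then adding formulas of $\mathcal{F}(\Gamma,\Delta')$ to $\mathcal{O}$. Truth in a position, for formulas of $\mathcal{F}(\Gamma,\Delta)$: $\mathcal{C}\nVdash\bot$; for atomic $A[c_1,\dots,c_n]$, $\mathcal{C}\Vdash A[c_1,\dots,c_n]$ iff $A[c_1,\dots,c_n]\in\mathcal{O}$; for $\star\in\{\to,\wedge,\vee\}$, $\mathcal{C}\Vdash\psi\star\chi$ iff $\psi\star\chi\in\mathcal{O}\cup\mathcal{P}$ and $(\mathcal{C}\Vdash\psi)\star(\mathcal{C}\Vdash\chi)$ holds with $\star$ read classically; for $q\in\{\forall,\exists\}$, $\mathcal{C}\Vdash qxP[x]$ iff $qxP[x]\in\mathcal{O}\cup\mathcal{P}$ and for $q$ (read classically) $\alpha\in\Delta$, $\mathcal{C}\Vdash P[\alpha]$. A formula of $\mathcal{P}$ (resp. $\mathcal{O}$) false in the current position is a mistake of Proponent (resp. Opponent). If Opponent has no mistakes but Proponent has a mistake, Proponent must move; otherwise Opponent must move. If after a player's move that same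 player must move again, that player loses and the game ends. If the game continues infinitely, Proponent wins.
   Formalization: Models interpret only the constants occurring in Γ, and domains may be empty; if Ω has a constant but Γ has none, the literal claim fails, e.g. for 𝒪₀ = ∅ and φ = ∃x(P[x]→P[x]), which is then valid although Proponent loses with Δ₀ = ∅. *)

theory Defs
  imports Main
begin

section \<open>The language\<close>

text \<open>
  A predicate symbol is a pair of a name and a number of arguments, so no arity bookkeeping is
  needed. The type \<open>'c\<close> is a universe of objects: the constants of the language are some of its
  elements, and the individuals which enter the game later are further ones.
\<close>

datatype 'c tm = Var nat | Con 'c

datatype ('p, 'c) fm =
    Bot
  | Atom 'p "'c tm list"
  | Imp "('p, 'c) fm" "('p, 'c) fm"
  | And "('p, 'c) fm" "('p, 'c) fm"
  | Or "('p, 'c) fm" "('p, 'c) fm"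
  | All nat "('p, 'c) fm"
  | Ex nat "('p, 'c) fm"

primrec vars_tm :: "'c tm \<Rightarrow> nat set" where
  "vars_tm (Var x) = {x}"
| "vars_tm (Con c) = {}"

primrec consts_tm :: "'c tm \<Rightarrow> 'c set" where
  "consts_tm (Var x) = {}"
| "consts_tm (Con c) = {c}"

primrec fv :: "('p, 'c) fm \<Rightarrow> nat set" where
  "fv Bot = {}"
| "fv (Atom p ts) = (\<Union>t\<in>set ts. vars_tm t)"
| "fv (Imp A B) = fv A \<union> fv B"
| "fv (And A B) = fv A \<union> fv B"
| "fv (Or A B) = fv A \<union> fv B"
| "fv (All x A) = fv A - {x}"
| "fv (Ex x A) = fv A - {x}"

definition closed_fm :: "('p, 'c) fm \<Rightarrow> bool" where
  "closed_fm A \<longleftrightarrow> fv A = {}"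

primrec consts_fm :: "('p, 'c) fm \<Rightarrow> 'c set" where
  "consts_fm Bot = {}"
| "consts_fm (Atom p ts) = (\<Union>t\<in>set ts. consts_tm t)"
| "consts_fm (Imp A B) = consts_fm A \<union> consts_fm B"
| "consts_fm (And A B) = consts_fm A \<union> consts_fm B"
| "consts_fm (Or A B) = consts_fm A \<union> consts_fm B"
| "consts_fm (All x A) = consts_fm A"
| "consts_fm (Ex x A) = consts_fm A"

definition constants_of :: "('p, 'c) fm set \<Rightarrow> 'c set" where
  "constants_of T = (\<Union>A\<in>T. consts_fm A)"

primrec subfms :: "('p, 'c) fm \<Rightarrow> ('p, 'c) fm set" where
  "subfms Bot = {Bot}"
| "subfms (Atom p ts) = {Atom p ts}"
| "subfms (Imp A B) = insert (Imp A B) (subfms A \<union> subfms B)"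
| "subfms (And A B) = insert (And A B) (subfms A \<union> subfms B)"
| "subfms (Or A B) = insert (Or A B) (subfms A \<union> subfms B)"
| "subfms (All x A) = insert (All x A) (subfms A)"
| "subfms (Ex x A) = insert (Ex x A) (subfms A)"

text \<open>
  \<open>inst s A\<close> puts the object \<open>c\<close> for the free occurrences of \<open>x\<close> whenever \<open>s x = Some c\<close>.
  Only objects are substituted, so no variable can be captured.
\<close>

primrec inst_tm :: "(nat \<rightharpoonup> 'c) \<Rightarrow> 'c tm \<Rightarrow> 'c tm" where
  "inst_tm s (Var x) = (case s x of None \<Rightarrow> Var x | Some c \<Rightarrow> Con c)"
| "inst_tm s (Con c) = Con c"

primrec inst :: "(nat \<rightharpoonup> 'c) \<Rightarrow> ('p, 'c) fm \<Rightarrow> ('p, 'c) fm" where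
  "inst s Bot = Bot"
| "inst s (Atom p ts) = Atom p (map (inst_tm s) ts)"
| "inst s (Imp A B) = Imp (inst s A) (inst s B)"
| "inst s (And A B) = And (inst s A) (inst s B)"
| "inst s (Or A B) = Or (inst s A) (inst s B)"
| "inst s (All x A) = All x (inst (s(x := None)) A)"
| "inst s (Ex x A) = Ex x (inst (s(x := None)) A)"

section \<open>Kripke semantics\<close>

record ('w, 'd) frame =
  worlds :: "'w set"
  acc :: "('w \<times> 'w) set"
  dom_at :: "'w \<Rightarrow> 'd set"

text \<open>Individual domains are allowed to be empty.\<close>

definition kripke_frame :: "('w, 'd) frame \<Rightarrow> bool" where
  "kripke_frame F \<longleftrightarrow>
     partial_order_on (worlds F) (acc F) \<and>
     (\<forall>(w, v)\<in>acc F. dom_at F w \<subseteq> dom_at F v)"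

text \<open>
  \<open>K\<close> is the set of constants of the language that the model interprets; \<open>I\<close> interprets the
  constants (rigidly) and \<open>V w p\<close> is the set of tuples of which \<open>p\<close> holds at \<open>w\<close>.
\<close>

definition kripke_model ::
  "('w, 'd) frame \<Rightarrow> 'c set \<Rightarrow> ('c \<Rightarrow> 'd) \<Rightarrow> ('w \<Rightarrow> 'p \<Rightarrow> 'd list set) \<Rightarrow> bool" where
  "kripke_model F K I V \<longleftrightarrow>
     kripke_frame F \<and>
     (\<forall>c\<in>K. \<forall>w\<in>worlds F. I c \<in> dom_at F w) \<and>
     (\<forall>w\<in>worlds F. \<forall>p. V w p \<subseteq> lists (dom_at F w)) \<and>
     (\<forall>(w, v)\<in>acc F. \<forall>p. V w p \<subseteq> V v p)"

primrec tm_val :: "('c \<Rightarrow> 'd) \<Rightarrow> (nat \<Rightarrow> 'd) \<Rightarrow> 'c tm \<Rightarrow> 'd" where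
  "tm_val I e (Var x) = e x"
| "tm_val I e (Con c) = I c"

primrec forces ::
  "('w, 'd) frame \<Rightarrow> ('c \<Rightarrow> 'd) \<Rightarrow> ('w \<Rightarrow> 'p \<Rightarrow> 'd list set) \<Rightarrow>
   ('p, 'c) fm \<Rightarrow> 'w \<Rightarrow> (nat \<Rightarrow> 'd) \<Rightarrow> bool" where
  "forces F I V Bot w e \<longleftrightarrow> False"
| "forces F I V (Atom p ts) w e \<longleftrightarrow> map (tm_val I e) ts \<in> V w p"
| "forces F I V (Imp A B) w e \<longleftrightarrow>
     (\<forall>v. (w, v) \<in> acc F \<longrightarrow> forces F I V A v e \<longrightarrow> forces F I V B v e)"
| "forces F I V (And A B) w e \<longleftrightarrow> forces F I V A w e \<and> forces F I V B w e"
| "forces F I V (Or A B) w e \<longleftrightarrow> forces F I V A w e \<or> forces F I V B w e"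
| "forces F I V (All x A) w e \<longleftrightarrow>
     (\<forall>v. (w, v) \<in> acc F \<longrightarrow> (\<forall>d\<in>dom_at F v. forces F I V A v (e(x := d))))"
| "forces F I V (Ex x A) w e \<longleftrightarrow> (\<exists>d\<in>dom_at F w. forces F I V A w (e(x := d)))"

definition true_at ::
  "('w, 'd) frame \<Rightarrow> ('c \<Rightarrow> 'd) \<Rightarrow> ('w \<Rightarrow> 'p \<Rightarrow> 'd list set) \<Rightarrow> 'w \<Rightarrow> ('p, 'c) fm \<Rightarrow> bool" where
  "true_at F I V w A \<longleftrightarrow>
     (\<forall>e. (\<forall>x\<in>fv A. e x \<in> dom_at F w) \<longrightarrow> forces F I V A w e)"

text \<open>
  The models interpret the constants that occur in the formulas at hand. A further constant could
  only matter if no constant occurs at all, where it would force all domains to be nonempty.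
\<close>

definition consequence ::
  "('w, 'd) frame set \<Rightarrow> ('p, 'c) fm set \<Rightarrow> ('p, 'c) fm \<Rightarrow> bool" where
  "consequence X T A \<longleftrightarrow>
     (\<forall>F\<in>X. \<forall>I V. kripke_model F (constants_of (T \<union> {A})) I V \<longrightarrow>
        (\<forall>w\<in>worlds F. \<forall>B\<in>T. true_at F I V w B) \<longrightarrow>
        (\<forall>w\<in>worlds F. true_at F I V w A))"

definition valid_on :: "('w, 'd) frame \<Rightarrow> ('p, 'c) fm \<Rightarrow> bool" where
  "valid_on F A \<longleftrightarrow> consequence {F} {} A"

text \<open>
  Validity on a frame quantifies over all interpretations of the predicate symbol of Casari's
  formula, so a language with just that symbol is enough to state it.
\<close>

definition casari :: "(unit, unit) fm" where
  "casari = (let P = Atom () [Var 0] in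
     Imp (All 0 (Imp (Imp P (All 0 P)) (All 0 P))) (All 0 P))"

definition Cas :: "('w, 'd) frame set" where
  "Cas = {F. kripke_frame F \<and> valid_on F casari}"

section \<open>The game\<close>

definition inst_fms :: "('p, 'c) fm set \<Rightarrow> 'c set \<Rightarrow> ('p, 'c) fm set" where
  "inst_fms G D =
     {inst s A | s A. (\<exists>B\<in>G. A \<in> subfms B) \<and> fv A \<subseteq> dom s \<and> ran s \<subseteq> D}"

record ('p, 'c) position =
  opp :: "('p, 'c) fm set"
  pro :: "('p, 'c) fm set"
  objs :: "'c set"

lemma size_inst [simp]: "size (inst s A) = size A"
proof (induction A arbitrary: s)
  case (Atom p ts)
  have "size (inst_tm s t) = size t" for t :: "'b tm"
    by (cases t) (auto split: option.split)
  then show ?case by (simp add: comp_def)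
qed auto

function holds :: "('p, 'c) position \<Rightarrow> ('p, 'c) fm \<Rightarrow> bool" where
  "holds C Bot \<longleftrightarrow> False"
| "holds C (Atom p ts) \<longleftrightarrow> Atom p ts \<in> opp C"
| "holds C (Imp A B) \<longleftrightarrow> Imp A B \<in> opp C \<union> pro C \<and> (holds C A \<longrightarrow> holds C B)"
| "holds C (And A B) \<longleftrightarrow> And A B \<in> opp C \<union> pro C \<and> (holds C A \<and> holds C B)"
| "holds C (Or A B) \<longleftrightarrow> Or A B \<in> opp C \<union> pro C \<and> (holds C A \<or> holds C B)"
| "holds C (All x A) \<longleftrightarrow>
     All x A \<in> opp C \<union> pro C \<and> (\<forall>a\<in>objs C. holds C (inst [x \<mapsto> a] A))"
| "holds C (Ex x A) \<longleftrightarrow>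
     Ex x A \<in> opp C \<union> pro C \<and> (\<exists>a\<in>objs C. holds C (inst [x \<mapsto> a] A))"
  by pat_completeness auto
termination by (relation "measure (\<lambda>(C, A). size A)") auto

datatype player = Opponent | Proponent

fun mistakes :: "player \<Rightarrow> ('p, 'c) position \<Rightarrow> ('p, 'c) fm set" where
  "mistakes Opponent C = {A \<in> opp C. \<not> holds C A}"
| "mistakes Proponent C = {A \<in> pro C. \<not> holds C A}"

definition to_move :: "('p, 'c) position \<Rightarrow> player" where
  "to_move C =
     (if mistakes Opponent C = {} \<and> mistakes Proponent C \<noteq> {} then Proponent else Opponent)"

fun move :: "player \<Rightarrow> ('p, 'c) fm set \<Rightarrow> ('p, 'c) position \<Rightarrow> ('p, 'c) position \<Rightarrow> bool" where
  "move Proponent G C C' \<longleftrightarrow>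
     (\<exists>S \<subseteq> inst_fms G (objs C). C' = C\<lparr>pro := pro C \<union> S\<rparr>)"
| "move Opponent G C C' \<longleftrightarrow>
     (\<exists>D S. objs C \<subseteq> D \<and> S \<subseteq> inst_fms G D \<and> C' = C\<lparr>opp := opp C \<union> S, objs := D\<rparr>)"

abbreviation legal :: "('p, 'c) fm set \<Rightarrow> ('p, 'c) position \<Rightarrow> ('p, 'c) position \<Rightarrow> bool" where
  "legal G C C' \<equiv> move (to_move C) G C C'"

text \<open>
  A history is a nonempty list of successive positions in which the game has not ended before the
  last one. The move from \<open>C\<close> to \<open>C'\<close> ends the game iff \<open>to_move C' = to_move C\<close>; this player
  then loses.
\<close>

definition history :: "('p, 'c) fm set \<Rightarrow> ('p, 'c) position \<Rightarrow> ('p, 'c) position list \<Rightarrow> bool" where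
  "history G C0 h \<longleftrightarrow>
     h \<noteq> [] \<and> hd h = C0 \<and>
     (\<forall>i. Suc i < length h \<longrightarrow> legal G (h ! i) (h ! Suc i)) \<and>
     (\<forall>i. Suc (Suc i) < length h \<longrightarrow> to_move (h ! i) \<noteq> to_move (h ! Suc i))"

definition ended :: "('p, 'c) position list \<Rightarrow> bool" where
  "ended h \<longleftrightarrow> length h \<ge> 2 \<and> to_move (last (butlast h)) = to_move (last h)"

datatype ('p, 'c) play =
    Finite_Play "('p, 'c) position list"
  | Infinite_Play "nat \<Rightarrow> ('p, 'c) position"

fun complete_play :: "('p, 'c) fm set \<Rightarrow> ('p, 'c) position \<Rightarrow> ('p, 'c) play \<Rightarrow> bool" where
  "complete_play G C0 (Finite_Play h) \<longleftrightarrow> history G C0 h \<and> ended h"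
| "complete_play G C0 (Infinite_Play f) \<longleftrightarrow>
     f 0 = C0 \<and> (\<forall>i. legal G (f i) (f (Suc i))) \<and> (\<forall>i. to_move (f i) \<noteq> to_move (f (Suc i)))"

fun proponent_wins :: "('p, 'c) play \<Rightarrow> bool" where
  "proponent_wins (Finite_Play h) \<longleftrightarrow> to_move (last h) = Opponent"
| "proponent_wins (Infinite_Play f) \<longleftrightarrow> True"

text \<open>A strategy maps each history to the position reached by the chosen move.\<close>

type_synonym ('p, 'c) strategy = "('p, 'c) position list \<Rightarrow> ('p, 'c) position"

definition follows_list :: "('p, 'c) strategy \<Rightarrow> ('p, 'c) position list \<Rightarrow> bool" where
  "follows_list \<sigma> h \<longleftrightarrow>
     (\<forall>i. Suc i < length h \<longrightarrow> to_move (h ! i) = Proponent \<longrightarrow> h ! Suc i = \<sigma> (take (Suc i) h))"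

fun follows :: "('p, 'c) strategy \<Rightarrow> ('p, 'c) play \<Rightarrow> bool" where
  "follows \<sigma> (Finite_Play h) \<longleftrightarrow> follows_list \<sigma> h"
| "follows \<sigma> (Infinite_Play f) \<longleftrightarrow>
     (\<forall>i. to_move (f i) = Proponent \<longrightarrow> f (Suc i) = \<sigma> (map f [0..<Suc i]))"

definition winning_strategy ::
  "('p, 'c) fm set \<Rightarrow> ('p, 'c) position \<Rightarrow> ('p, 'c) strategy \<Rightarrow> bool" where
  "winning_strategy G C0 \<sigma> \<longleftrightarrow>
     (\<forall>h. history G C0 h \<and> follows_list \<sigma> h \<and> \<not> ended h \<and> to_move (last h) = Proponent \<longrightarrow>
          legal G (last h) (\<sigma> h)) \<and>
     (\<forall>p. complete_play G C0 p \<and> follows \<sigma> p \<longrightarrow> proponent_wins p)"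

definition proponent_has_winning_strategy ::
  "('p, 'c) fm set \<Rightarrow> ('p, 'c) position \<Rightarrow> bool" where
  "proponent_has_winning_strategy G C0 \<longleftrightarrow> (\<exists>\<sigma>. winning_strategy G C0 \<sigma>)"

end

theory Submission
  imports Defs "HOL-Library.Countable_Set"
begin

text \<open>
  Proponent's condition is a safety condition, so the game is determined: either Proponent can
  keep the play inside a region closed under the moves, or Opponent wins in a well-founded way.

  If Proponent wins and a model on a Casari frame refuted the consequence, Opponent could play the
  sets of formulas forced at the worlds of this model. He always moves to a world that is stable
  for Proponent's formulas: at every later world where one of them still fails, the domain and the
  forced formulas are the same. There truth in the position is forcing. Along a strictly
  increasing sequence of worlds of a Casari frame the union of the domains is finite, which gives
  the stable worlds and makes the play finite.

  If Opponent wins, well-founded induction on his wins yields a countermodel without infinite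
  strictly increasing sequences, hence on a Casari frame: at a position where Proponent must move
  let him add all consequences of Opponent's formulas; if he still must move, glue countermodels
  to all other formulas under a new root which realizes the position.

  The objects of the game, the worlds and the individuals of the frames live in unrelated infinite
  types, so both directions pass through a countable elementary submodel.
\<close>

section \<open>Instances of subformulas\<close>

lemma inst_tm_inst_tm: "inst_tm t (inst_tm s a) = inst_tm (t ++ s) a"
  by (cases a) (auto simp: map_add_def split: option.split)

text \<open>An object once put in for a variable is never replaced, so the inner substitution
  \<open>s\<close> takes precedence, as the right operand of \<open>++\<close> does.\<close>

lemma inst_inst: "inst t (inst s A) = inst (t ++ s) A"
proof -
  have upd: "(t ++ s)(x := None) = t(x := None) ++ s(x := None)"
    for t s :: "nat \<rightharpoonup> 'b" and x
    by (auto simp: map_add_def fun_eq_iff split: option.split)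
  show ?thesis
    by (induction A arbitrary: s t) (auto simp: inst_tm_inst_tm upd)
qed

lemma inst_cong: "(\<And>x. x \<in> fv A \<Longrightarrow> s x = t x) \<Longrightarrow> inst s A = inst t A"
proof (induction A arbitrary: s t)
  case (Atom p ts)
  have "s x = t x" if "Var x \<in> set ts" for x
    using Atom[of x] that by force
  then have "inst_tm s a = inst_tm t a" if "a \<in> set ts" for a
    using that by (cases a) simp_all
  then show ?case by simp
next
  case (All x A)
  then have "inst (s(x := None)) A = inst (t(x := None)) A" by (intro All.IH) auto
  then show ?case by simp
next
  case (Ex x A)
  then have "inst (s(x := None)) A = inst (t(x := None)) A" by (intro Ex.IH) auto
  then show ?case by simp
next
  case (Imp A B)
  from Imp.prems have "inst s A = inst t A" by (intro Imp.IH(1)) simp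
  moreover from Imp.prems have "inst s B = inst t B" by (intro Imp.IH(2)) simp
  ultimately show ?case by simp
next
  case (And A B)
  from And.prems have "inst s A = inst t A" by (intro And.IH(1)) simp
  moreover from And.prems have "inst s B = inst t B" by (intro And.IH(2)) simp
  ultimately show ?case by simp
next
  case (Or A B)
  from Or.prems have "inst s A = inst t A" by (intro Or.IH(1)) simp
  moreover from Or.prems have "inst s B = inst t B" by (intro Or.IH(2)) simp
  ultimately show ?case by simp
qed simp

lemma inst_closed: "fv A = {} \<Longrightarrow> inst s A = A"
proof -
  have id: "inst (\<lambda>_. None) A = A" for A :: "('a, 'b) fm"
  proof (induction A)
    case (Atom p ts)
    have "inst_tm (\<lambda>_. None) a = a" for a :: "'b tm"
      by (cases a) auto
    then show ?case by (simp add: map_idI)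
  qed (auto simp: fun_upd_idem)
  assume "fv A = {}"
  then show ?thesis using inst_cong[of A s "\<lambda>_. None"] id by simp
qed

lemma fv_inst: "fv (inst s A) = fv A - dom s"
proof (induction A arbitrary: s)
  case (Atom p ts)
  have "vars_tm (inst_tm s a) = vars_tm a - dom s" for a
    by (cases a) (auto split: option.split)
  then show ?case by auto
qed auto

lemma consts_inst: "consts_fm (inst s A) \<subseteq> consts_fm A \<union> ran s"
proof (induction A arbitrary: s)
  case (Atom p ts)
  have "consts_tm (inst_tm s a) \<subseteq> consts_tm a \<union> ran s" for a
    by (cases a) (auto split: option.split intro: ranI)
  then show ?case by fastforce
next
  case (All x A)
  have "ran (s(x := None)) \<subseteq> ran s" by (auto simp: ran_def)
  with All[of "s(x := None)"] show ?case unfolding inst.simps consts_fm.simps by blast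
next
  case (Ex x A)
  have "ran (s(x := None)) \<subseteq> ran s" by (auto simp: ran_def)
  with Ex[of "s(x := None)"] show ?case unfolding inst.simps consts_fm.simps by blast
qed fastforce+

lemma finite_fv: "finite (fv A)"
proof -
  have "finite (vars_tm t)" for t :: "'b tm" by (cases t) auto
  then show ?thesis by (induction A) auto
qed

lemma finite_consts_fm: "finite (consts_fm (A :: ('a, 'b) fm))"
proof -
  have "finite (consts_tm t)" for t :: "'b tm" by (cases t) auto
  then show ?thesis by (induction A) auto
qed

lemma subfms_refl [simp]: "A \<in> subfms A"
  by (cases A) auto

lemma subfms_trans: "A \<in> subfms B \<Longrightarrow> B \<in> subfms C \<Longrightarrow> A \<in> subfms C"
  by (induction C) auto

lemma finite_subfms: "finite (subfms A)"
  by (induction A) auto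

lemma consts_subfms: "A \<in> subfms B \<Longrightarrow> consts_fm A \<subseteq> consts_fm B"
  by (induction B) auto

section \<open>Closure and finiteness of the set of formulas available in the game\<close>

lemma inst_fmsI:
  "B \<in> G \<Longrightarrow> A \<in> subfms B \<Longrightarrow> fv A \<subseteq> dom s \<Longrightarrow> ran s \<subseteq> D \<Longrightarrow> inst s A \<in> inst_fms G D"
  unfolding inst_fms_def by blast

lemma inst_fmsE:
  assumes "A \<in> inst_fms G D"
  obtains s A' B where "A = inst s A'" "B \<in> G" "A' \<in> subfms B" "fv A' \<subseteq> dom s" "ran s \<subseteq> D"
  using assms unfolding inst_fms_def by blast

lemma inst_fms_mono: "D \<subseteq> D' \<Longrightarrow> inst_fms G D \<subseteq> inst_fms G D'"
  unfolding inst_fms_def by blast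

lemma closed_in_inst_fms: "A \<in> G \<Longrightarrow> fv A = {} \<Longrightarrow> A \<in> inst_fms G D"
  using inst_fmsI[of A G A Map.empty D] inst_closed[of A] by simp

lemma inst_fms_closed: "A \<in> inst_fms G D \<Longrightarrow> fv A = {}"
  by (elim inst_fmsE) (auto simp: fv_inst)

lemma inst_fms_consts: "A \<in> inst_fms G D \<Longrightarrow> consts_fm A \<subseteq> constants_of G \<union> D"
proof (elim inst_fmsE)
  fix s A' B assume "A = inst s A'" "B \<in> G" "A' \<in> subfms B" "ran s \<subseteq> D"
  then show "consts_fm A \<subseteq> constants_of G \<union> D"
    using consts_inst[of s A'] consts_subfms[of A' B] unfolding constants_of_def by auto
qed

text \<open>The parts are instantiated by the same substitution as the whole, and
  \<open>subfms\<close> is transitive. The variable \<open>f\<close> ranges over constructors so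
  that one proof covers three connectives.\<close>

lemma inst_fms_binary:
  assumes "f \<in> {Imp, And, Or}" and "f A B \<in> inst_fms G D"
  shows "A \<in> inst_fms G D" and "B \<in> inst_fms G D"
proof -
  obtain s X Y where X: "f A B = inst s X" "Y \<in> G" "X \<in> subfms Y" "fv X \<subseteq> dom s" "ran s \<subseteq> D"
    using assms(2) by (rule inst_fmsE)
  then obtain A' B' where AB: "X = f A' B'" "A = inst s A'" "B = inst s B'"
    using assms(1) by (cases X) auto
  then have "A' \<in> subfms X" "B' \<in> subfms X" "fv A' \<subseteq> dom s" "fv B' \<subseteq> dom s"
    using assms(1) X(4) by auto
  then show "A \<in> inst_fms G D" "B \<in> inst_fms G D"
    using AB X inst_fmsI subfms_trans by metis+
qed

text \<open>The matrix was instantiated with \<open>x\<close> left free, so the object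
  \<open>a\<close> can be merged with the old substitution into
  \<open>s(x \<mapsto> a)\<close>.\<close>

lemma inst_fms_quantifier:
  assumes "q \<in> {All, Ex}" and "q x A \<in> inst_fms G D" and "a \<in> D"
  shows "inst [x \<mapsto> a] A \<in> inst_fms G D"
proof -
  obtain s X Y where X: "q x A = inst s X" "Y \<in> G" "X \<in> subfms Y" "fv X \<subseteq> dom s" "ran s \<subseteq> D"
    using assms(2) by (rule inst_fmsE)
  then obtain A' where A': "X = q x A'" "A = inst (s(x := None)) A'"
    using assms(1) by (cases X) auto
  then have "A' \<in> subfms X" "fv A' \<subseteq> dom (s(x \<mapsto> a))"
    using assms(1) X(4) by auto
  moreover have "ran (s(x \<mapsto> a)) \<subseteq> D" using X(5) assms(3) by (auto simp: ran_def)
  moreover have "[x \<mapsto> a] ++ s(x := None) = s(x \<mapsto> a)"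
    by (auto simp: map_add_def fun_eq_iff split: option.split)
  ultimately show ?thesis
    using A'(2) X(2,3) inst_fmsI subfms_trans by (metis inst_inst)
qed

text \<open>Only the values of a substitution on the free variables matter, and there are finitely
  many partial maps between finite sets. This bounds the formulas forced along an ascent whose
  domains have a finite union.\<close>

lemma finite_inst_fms:
  assumes "finite G" and "finite D"
  shows "finite (inst_fms G D)"
proof -
  have "inst_fms G D \<subseteq>
      (\<Union>B\<in>G. \<Union>A\<in>subfms B. (\<lambda>s. inst s A) ` {s. dom s = fv A \<and> ran s \<subseteq> D})"
  proof
    fix X assume "X \<in> inst_fms G D"
    then obtain s A B where X: "X = inst s A" "B \<in> G" "A \<in> subfms B" "fv A \<subseteq> dom s" "ran s \<subseteq> D"
      by (rule inst_fmsE)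
    have "X = inst (s |` fv A) A" unfolding X(1) by (rule inst_cong) simp
    moreover have "dom (s |` fv A) = fv A" "ran (s |` fv A) \<subseteq> D"
      using X(4,5) by (auto simp: ran_def restrict_map_def split: if_splits)
    ultimately show "X \<in> (\<Union>B\<in>G. \<Union>A\<in>subfms B. (\<lambda>s. inst s A) ` {s. dom s = fv A \<and> ran s \<subseteq> D})"
      using X(2,3) by blast
  qed
  moreover have "finite (\<Union>B\<in>G. \<Union>A\<in>subfms B. (\<lambda>s. inst s A) ` {s. dom s = fv A \<and> ran s \<subseteq> D})"
    using assms by (auto simp: finite_subfms finite_fv intro!: finite_set_of_finite_maps)
  ultimately show ?thesis by (rule finite_subset)
qed

section \<open>Forcing\<close>

lemma kripke_frameD:
  assumes "kripke_frame F"
  shows "w \<in> worlds F \<Longrightarrow> (w, w) \<in> acc F"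
    and "(u, v) \<in> acc F \<Longrightarrow> (v, w) \<in> acc F \<Longrightarrow> (u, w) \<in> acc F"
    and "(v, w) \<in> acc F \<Longrightarrow> (w, v) \<in> acc F \<Longrightarrow> v = w"
    and "(v, w) \<in> acc F \<Longrightarrow> v \<in> worlds F \<and> w \<in> worlds F"
    and "(v, w) \<in> acc F \<Longrightarrow> dom_at F v \<subseteq> dom_at F w"
  using assms
  unfolding kripke_frame_def partial_order_on_def preorder_on_def refl_on_def trans_def antisym_def
  by blast+

lemma kripke_modelD:
  assumes "kripke_model F K I V"
  shows "kripke_frame F"
    and "c \<in> K \<Longrightarrow> w \<in> worlds F \<Longrightarrow> I c \<in> dom_at F w"
    and "w \<in> worlds F \<Longrightarrow> V w p \<subseteq> lists (dom_at F w)"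
    and "(w, v) \<in> acc F \<Longrightarrow> V w p \<subseteq> V v p"
  using assms unfolding kripke_model_def by blast+

lemma forces_cong:
  "(\<And>x. x \<in> fv A \<Longrightarrow> e x = e' x) \<Longrightarrow> forces F I V A w e = forces F I V A w e'"
proof (induction A arbitrary: w e e')
  case (Atom p ts)
  have "e x = e' x" if "Var x \<in> set ts" for x
    using Atom[of x] that by force
  then have "tm_val I e a = tm_val I e' a" if "a \<in> set ts" for a
    using that by (cases a) simp_all
  then show ?case by (simp cong: map_cong)
next
  case (Imp A B)
  from Imp.prems have "forces F I V A v e = forces F I V A v e'" for v by (intro Imp.IH(1)) simp
  moreover from Imp.prems have "forces F I V B v e = forces F I V B v e'" for v by (intro Imp.IH(2)) simp
  ultimately show ?case by simp
next
  case (And A B)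
  from And.prems have "forces F I V A v e = forces F I V A v e'" for v by (intro And.IH(1)) simp
  moreover from And.prems have "forces F I V B v e = forces F I V B v e'" for v by (intro And.IH(2)) simp
  ultimately show ?case by simp
next
  case (Or A B)
  from Or.prems have "forces F I V A v e = forces F I V A v e'" for v by (intro Or.IH(1)) simp
  moreover from Or.prems have "forces F I V B v e = forces F I V B v e'" for v by (intro Or.IH(2)) simp
  ultimately show ?case by simp
next
  case (All x A)
  then have "forces F I V A v (e(x := d)) = forces F I V A v (e'(x := d))" for v d
    by (intro All.IH) auto
  then show ?case by simp
next
  case (Ex x A)
  then have "forces F I V A v (e(x := d)) = forces F I V A v (e'(x := d))" for v d
    by (intro Ex.IH) auto
  then show ?case by simp
qed simp

lemma forces_mono:
  assumes "kripke_model F K I V" and "(w, v) \<in> acc F" and "forces F I V A w e"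
  shows "forces F I V A v e"
  using assms(2,3)
proof (induction A arbitrary: e)
  case (Atom p ts)
  then show ?case using kripke_modelD(4)[OF assms(1)] by auto
next
  case (Ex x A)
  then show ?case using kripke_frameD(5)[OF kripke_modelD(1)[OF assms(1)]] by fastforce
qed (use kripke_frameD(2)[OF kripke_modelD(1)[OF assms(1)]] in force)+

text \<open>Objects of the game serve as individuals and name themselves, so constants are
  interpreted by the identity and substitution amounts to a change of environment.\<close>

lemma forces_inst:
  "forces F (\<lambda>c. c) V (inst s A) w e =
     forces F (\<lambda>c. c) V A w (\<lambda>x. case s x of None \<Rightarrow> e x | Some c \<Rightarrow> c)"
proof (induction A arbitrary: s w e)
  case (Atom p ts)
  have "tm_val (\<lambda>c. c) e (inst_tm s a) = tm_val (\<lambda>c. c) (\<lambda>x. case s x of None \<Rightarrow> e x | Some c \<Rightarrow> c) a" for a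
    by (cases a) (auto split: option.split)
  then show ?case by (simp add: comp_def)
next
  case (All x A)
  have "(\<lambda>y. case (s(x := None)) y of None \<Rightarrow> (e(x := d)) y | Some c \<Rightarrow> c) =
        (\<lambda>y. case s y of None \<Rightarrow> e y | Some c \<Rightarrow> c)(x := d)" for d
    by (auto simp: fun_eq_iff split: option.split)
  then show ?case by (simp add: All)
next
  case (Ex x A)
  have "(\<lambda>y. case (s(x := None)) y of None \<Rightarrow> (e(x := d)) y | Some c \<Rightarrow> c) =
        (\<lambda>y. case s y of None \<Rightarrow> e y | Some c \<Rightarrow> c)(x := d)" for d
    by (auto simp: fun_eq_iff split: option.split)
  then show ?case by (simp add: Ex)
qed auto

lemma forces_inst_single: "forces F (\<lambda>c. c) V (inst [x \<mapsto> d] A) w e = forces F (\<lambda>c. c) V A w (e(x := d))"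
proof -
  have "(\<lambda>y. case [x \<mapsto> d] y of None \<Rightarrow> e y | Some c \<Rightarrow> c) = e(x := d)"
    by (auto simp: fun_eq_iff)
  then show ?thesis by (simp add: forces_inst)
qed

text \<open>The bridge between game and models, used in both directions. Truth in a position is the
  classical truth table plus membership in \<open>opp C \<union> pro C\<close>. Membership comes
  from \<open>mem\<close>. Conjunction, disjunction and \<exists> are local to \<open>v\<close>;
  only \<longrightarrow> and \<forall>, which look at later worlds, need the assumptions
  \<open>imp\<close> and \<open>all\<close>.\<close>

lemma holds_iff_forces:
  assumes F: "kripke_frame F" and v: "v \<in> worlds F" and objs: "objs C = dom_at F v"
    and atom: "\<And>p ts. Atom p ts \<in> inst_fms G (objs C) \<Longrightarrow>
                 forces F (\<lambda>c. c) V (Atom p ts) v e \<longleftrightarrow> Atom p ts \<in> opp C"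
    and mem: "\<And>A. A \<in> inst_fms G (objs C) \<Longrightarrow> forces F (\<lambda>c. c) V A v e \<Longrightarrow> A \<in> opp C \<union> pro C"
    and imp: "\<And>A B. Imp A B \<in> inst_fms G (objs C) \<Longrightarrow> Imp A B \<in> opp C \<union> pro C \<Longrightarrow>
                (forces F (\<lambda>c. c) V A v e \<Longrightarrow> forces F (\<lambda>c. c) V B v e) \<Longrightarrow> forces F (\<lambda>c. c) V (Imp A B) v e"
    and all: "\<And>x A. All x A \<in> inst_fms G (objs C) \<Longrightarrow> All x A \<in> opp C \<union> pro C \<Longrightarrow>
                (\<And>a. a \<in> dom_at F v \<Longrightarrow> forces F (\<lambda>c. c) V A v (e(x := a))) \<Longrightarrow>
                forces F (\<lambda>c. c) V (All x A) v e"
    and A: "A \<in> inst_fms G (objs C)"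
  shows "holds C A \<longleftrightarrow> forces F (\<lambda>c. c) V A v e"
proof -
  note refl = kripke_frameD(1)[OF F v]
  show ?thesis
    using A
  \<comment> \<open>The induction is on size because the quantifier clauses of \<open>holds\<close>
    pass to an instance, which is not a structural part.\<close>
  proof (induction A rule: measure_induct_rule[of size])
    case (less X)
    have binary: "holds C A = forces F (\<lambda>c. c) V A v e \<and> holds C B = forces F (\<lambda>c. c) V B v e"
      if "f \<in> {Imp, And, Or}" "X = f A B" for f A B
      using less.IH[of A] less.IH[of B] inst_fms_binary[of f A B G] less.prems that by auto
    have quantifier: "holds C (inst [x \<mapsto> a] A) = forces F (\<lambda>c. c) V A v (e(x := a))"
      if "q \<in> {All, Ex}" "X = q x A" "a \<in> objs C" for q x A a
      using less.IH[of "inst [x \<mapsto> a] A"] inst_fms_quantifier[of q x A G "objs C" a] less.prems that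
      by (auto simp: forces_inst_single)
    show ?case
    proof (cases X)
      case (Atom p ts)
      then show ?thesis using atom[of p ts] less.prems by simp
    next
      case (Imp A B)
      then show ?thesis using binary[of Imp A B] imp[of A B] mem[of X] refl less.prems by auto
    next
      case (And A B)
      then show ?thesis using binary[of And A B] mem[of X] less.prems by auto
    next
      case (Or A B)
      then show ?thesis using binary[of Or A B] mem[of X] less.prems by auto
    next
      case (All x A)
      then show ?thesis using quantifier[of All x A] all[of x A] mem[of X] refl objs less.prems by auto
    next
      case (Ex x A)
      then show ?thesis using quantifier[of Ex x A] mem[of X] objs less.prems by auto
    qed simp
  qed
qed

section \<open>Winning regions\<close>

text \<open>A memoryless substitute for a winning strategy. A move after which the same player must
  move again loses at once, so Proponent has to avoid it, while such a move of Opponent need not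
  lead back into \<open>R\<close>.\<close>

definition winning_region :: "('p, 'c) fm set \<Rightarrow> ('p, 'c) position set \<Rightarrow> bool" where
  "winning_region G R \<longleftrightarrow>
     (\<forall>C\<in>R. to_move C = Proponent \<longrightarrow> (\<exists>C'\<in>R. legal G C C' \<and> to_move C' = Opponent)) \<and>
     (\<forall>C\<in>R. to_move C = Opponent \<longrightarrow>
        (\<forall>C'. legal G C C' \<longrightarrow> to_move C' = Proponent \<longrightarrow> C' \<in> R))"

declare move.simps [simp del]

lemma player_neq: "p \<noteq> q \<longleftrightarrow> (p = Proponent \<longleftrightarrow> q = Opponent)"
  by (cases p; cases q) auto

text \<open>\<open>history\<close> tests the alternation of turns only for pairs before the last
  one. The last pair of \<open>h\<close> becomes an inner pair after appending, and
  \<open>\<not> ended h\<close> supplies its alternation.\<close>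

lemma history_snoc:
  assumes "history G C0 h" and "\<not> ended h" and "legal G (last h) C"
  shows "history G C0 (h @ [C])"
  unfolding history_def
proof (intro conjI allI impI)
  have ne: "h \<noteq> []" using assms(1) by (simp add: history_def)
  then show "h @ [C] \<noteq> []" "hd (h @ [C]) = C0"
    using assms(1) by (auto simp: history_def)
  have last: "last h = h ! (length h - 1)" using ne by (rule last_conv_nth)
  show "legal G ((h @ [C]) ! i) ((h @ [C]) ! Suc i)" if "Suc i < length (h @ [C])" for i
  proof (cases "Suc i < length h")
    case True
    then show ?thesis using assms(1) by (simp add: history_def nth_append)
  next
    case False
    then have "length h = Suc i" using that by simp
    then show ?thesis using assms(3) last by (simp add: nth_append)
  qed
  show "to_move ((h @ [C]) ! i) \<noteq> to_move ((h @ [C]) ! Suc i)"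
    if "Suc (Suc i) < length (h @ [C])" for i
  proof (cases "Suc (Suc i) < length h")
    case True
    then show ?thesis using assms(1) by (simp add: history_def nth_append)
  next
    case False
    then have len: "length h = Suc (Suc i)" using that by simp
    then have "last (butlast h) = h ! i"
      by (metis Suc_lessD diff_Suc_1 last_conv_nth length_butlast lessI list.size(3) nat.distinct(1) nth_butlast)
    then show ?thesis using assms(2) last len by (simp add: ended_def nth_append)
  qed
qed

lemma follows_list_snoc:
  assumes "follows_list \<sigma> h" and "h \<noteq> []" and "to_move (last h) = Proponent \<Longrightarrow> C = \<sigma> h"
  shows "follows_list \<sigma> (h @ [C])"
  unfolding follows_list_def
proof (intro allI impI)
  fix i assume i: "Suc i < length (h @ [C])" "to_move ((h @ [C]) ! i) = Proponent"
  show "(h @ [C]) ! Suc i = \<sigma> (take (Suc i) (h @ [C]))"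
  proof (cases "Suc i < length h")
    case True
    then show ?thesis using assms(1) i by (simp add: follows_list_def nth_append)
  next
    case False
    then have "length h = Suc i" using i by simp
    then show ?thesis using assms(2,3) i by (simp add: nth_append last_conv_nth)
  qed
qed

text \<open>The region collects the last positions of all unfinished histories that agree with
  \<open>\<sigma>\<close>.\<close>

lemma winning_strategy_imp_region:
  assumes "winning_strategy G C0 \<sigma>"
  obtains R where "winning_region G R" and "C0 \<in> R"
proof
  let ?R = "{last h | h. history G C0 h \<and> follows_list \<sigma> h \<and> \<not> ended h}"
  have "C0 = last [C0] \<and> history G C0 [C0] \<and> follows_list \<sigma> [C0] \<and> \<not> ended [C0]"
    by (simp add: history_def follows_list_def ended_def)
  then show "C0 \<in> ?R" by blast
  have snoc: "\<exists>h'. C = last h' \<and> history G C0 h' \<and> follows_list \<sigma> h' \<and> \<not> ended h'"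
    if "history G C0 h" "follows_list \<sigma> h" "\<not> ended h" "legal G (last h) C"
      "to_move (last h) = Proponent \<Longrightarrow> C = \<sigma> h" "to_move C \<noteq> to_move (last h)" for h C
    using that history_snoc[of G C0 h C] follows_list_snoc[of \<sigma> h C]
    by (intro exI[of _ "h @ [C]"]) (auto simp: ended_def history_def)
  show "winning_region G ?R"
    unfolding winning_region_def
  proof (intro conjI ballI impI allI)
    fix C assume "C \<in> ?R" and P: "to_move C = Proponent"
    then obtain h where h: "C = last h" "history G C0 h" "follows_list \<sigma> h" "\<not> ended h" by blast
    then have legal: "legal G C (\<sigma> h)"
      using assms P by (simp add: winning_strategy_def)
    \<comment> \<open>If Proponent were still to move after his answer, appending it would give a
      finished play that follows \<open>\<sigma>\<close> and is lost.\<close>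
    have "to_move (\<sigma> h) = Opponent"
    proof (rule ccontr)
      assume "to_move (\<sigma> h) \<noteq> Opponent"
      then have "to_move (\<sigma> h) = Proponent" by (cases "to_move (\<sigma> h)") auto
      moreover have "complete_play G C0 (Finite_Play (h @ [\<sigma> h]))"
        using h legal history_snoc[of G C0 h "\<sigma> h"] P calculation
        by (auto simp: ended_def history_def Suc_le_eq)
      moreover have "follows \<sigma> (Finite_Play (h @ [\<sigma> h]))"
        using h follows_list_snoc[of \<sigma> h] by (auto simp: history_def)
      ultimately show False
        using assms unfolding winning_strategy_def by fastforce
    qed
    then show "\<exists>C'\<in>?R. legal G C C' \<and> to_move C' = Opponent"
      using snoc[OF h(2-4), of "\<sigma> h"] legal P h(1) by auto
  next
    fix C C' assume "C \<in> ?R" "to_move C = Opponent" "legal G C C'" "to_move C' = Proponent"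
    then show "C' \<in> ?R" using snoc by force
  qed
qed

text \<open>Infinite plays are won by definition. So it is enough to answer, from the last position
  alone, with any successor in \<open>R\<close> that hands the turn over, and to check finite
  plays.\<close>

lemma winning_region_imp_strategy:
  assumes R: "winning_region G R" and "C0 \<in> R"
  shows "proponent_has_winning_strategy G C0"
proof -
  define good where "good C C' \<longleftrightarrow> C' \<in> R \<and> legal G C C' \<and> to_move C' = Opponent" for C C'
  define \<sigma> where "\<sigma> h = (SOME C'. good (last h) C')" for h
  have \<sigma>: "good (last h) (\<sigma> h)" if "last h \<in> R" "to_move (last h) = Proponent" for h
    unfolding \<sigma>_def by (rule someI_ex) (use R that in \<open>auto simp: winning_region_def good_def\<close>)
  \<comment> \<open>The last position of a finished history is exempt, since a losing move of
    Opponent may leave \<open>R\<close>.\<close>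
  have in_R: "h ! i \<in> R"
    if h: "history G C0 h" "follows_list \<sigma> h" and "i < length h"
      and "i = length h - 1 \<Longrightarrow> \<not> ended h" for h i
    using that(3,4)
  proof (induction i)
    case 0
    then show ?case using h assms(2) by (simp add: history_def hd_conv_nth)
  next
    case (Suc i)
    then have i: "h ! i \<in> R" by simp
    have legal: "legal G (h ! i) (h ! Suc i)" using h Suc by (simp add: history_def)
    have neq: "to_move (h ! i) \<noteq> to_move (h ! Suc i)"
    proof (cases "Suc (Suc i) < length h")
      case True
      then show ?thesis using h by (simp add: history_def)
    next
      case False
      then have len: "length h = Suc (Suc i)" using Suc by simp
      then have "last h = h ! Suc i" "last (butlast h) = h ! i"
        by (simp_all add: last_conv_nth nth_butlast flip: length_greater_0_conv)
      then show ?thesis using Suc.prems(2) len by (simp add: ended_def)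
    qed
    show ?case
    proof (cases "to_move (h ! i)")
      case Opponent
      then show ?thesis using R i legal neq player_neq unfolding winning_region_def by metis
    next
      case Proponent
      have "last (take (Suc i) h) = h ! i" using Suc by (simp add: take_Suc_conv_app_nth)
      moreover have "h ! Suc i = \<sigma> (take (Suc i) h)"
        using h Suc Proponent by (simp add: follows_list_def)
      ultimately show ?thesis using \<sigma>[of "take (Suc i) h"] i Proponent by (simp add: good_def)
    qed
  qed
  have "winning_strategy G C0 \<sigma>"
    unfolding winning_strategy_def
  proof (intro conjI allI impI; elim conjE)
    fix h assume h: "history G C0 h" "follows_list \<sigma> h" "\<not> ended h" "to_move (last h) = Proponent"
    then have "last h \<in> R" using in_R[of h "length h - 1"]
      by (simp add: last_conv_nth history_def)
    then show "legal G (last h) (\<sigma> h)" using \<sigma> h(4) by (simp add: good_def)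
  next
    fix p assume p: "complete_play G C0 p" "follows \<sigma> p"
    show "proponent_wins p"
    proof (cases p)
      case (Finite_Play h)
      then have h: "history G C0 h" "follows_list \<sigma> h" "ended h" using p by auto
      then obtain i where len: "length h = Suc (Suc i)"
        by (cases h; cases "tl h") (auto simp: ended_def)
      then have l: "last h = h ! Suc i" "last (butlast h) = h ! i"
        by (simp_all add: last_conv_nth nth_butlast flip: length_greater_0_conv)
      \<comment> \<open>The last move starts inside \<open>R\<close>. Had Proponent made it, his
        answer would have handed the turn over, so the player who has to move twice is
        Opponent.\<close>
      have i: "h ! i \<in> R" using in_R[OF h(1,2)] len by simp
      have "last (take (Suc i) h) = h ! i" using len by (simp add: take_Suc_conv_app_nth)
      then have "to_move (h ! i) = Proponent \<Longrightarrow> to_move (h ! Suc i) = Opponent"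
        using \<sigma>[of "take (Suc i) h"] h(2) i len by (simp add: good_def follows_list_def)
      then have "to_move (h ! Suc i) = Opponent"
        using h(3) l by (cases "to_move (h ! i)") (auto simp: ended_def)
      then show ?thesis using Finite_Play l by simp
    qed simp
  qed
  then show ?thesis unfolding proponent_has_winning_strategy_def by blast
qed

section \<open>Determinacy and well-founded wins of Opponent\<close>

inductive opponent_wins :: "('p, 'c) fm set \<Rightarrow> ('p, 'c) position \<Rightarrow> bool" for G where
  proponent: "to_move C = Proponent \<Longrightarrow>
    (\<And>C'. legal G C C' \<Longrightarrow> to_move C' = Opponent \<Longrightarrow> opponent_wins G C') \<Longrightarrow> opponent_wins G C"
| opponent: "to_move C = Opponent \<Longrightarrow> legal G C C' \<Longrightarrow> to_move C' = Proponent \<Longrightarrow>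
    opponent_wins G C' \<Longrightarrow> opponent_wins G C"

text \<open>The positions not won by Opponent form a winning region: the two introduction rules,
  read contrapositively, are the two conditions on a region.\<close>

lemma opponent_wins_or_proponent_strategy:
  "opponent_wins G C0 \<or> proponent_has_winning_strategy G C0"
proof -
  have "winning_region G {C. \<not> opponent_wins G C}"
    unfolding winning_region_def using opponent_wins.intros[of _ G] by blast
  then show ?thesis using winning_region_imp_strategy[of G "{C. \<not> opponent_wins G C}" C0] by blast
qed

section \<open>Casari frames\<close>

definition noetherian :: "('w, 'd) frame \<Rightarrow> bool" where
  "noetherian F \<longleftrightarrow> wf {(v, w). (w, v) \<in> acc F \<and> w \<noteq> v}"

definition ascending :: "('w, 'd) frame \<Rightarrow> (nat \<Rightarrow> 'w) \<Rightarrow> bool" where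
  "ascending F f \<longleftrightarrow> (\<forall>n. (f n, f (Suc n)) \<in> acc F \<and> f n \<noteq> f (Suc n))"

text \<open>The part of Casari's condition that Opponent's play relies on. On a Kripke frame domains
  grow along the sequence, so a finite union makes them finite and eventually constant.\<close>

definition finite_ascents :: "('w, 'd) frame \<Rightarrow> bool" where
  "finite_ascents F \<longleftrightarrow> (\<forall>f. ascending F f \<longrightarrow> finite (\<Union>n. dom_at F (f n)))"

lemma noetherian_iff: "noetherian F \<longleftrightarrow> \<not> (\<exists>f. ascending F f)"
  unfolding noetherian_def wf_iff_no_infinite_down_chain ascending_def by auto

lemma forces_casari:
  "forces F I V casari w e \<longleftrightarrow>
     (\<forall>v. (w, v) \<in> acc F \<longrightarrow>
        (\<forall>u. (v, u) \<in> acc F \<longrightarrow> (\<forall>x\<in>dom_at F u. \<forall>u'. (u, u') \<in> acc F \<longrightarrow>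
           (\<forall>t. (u', t) \<in> acc F \<longrightarrow> [x] \<in> V t () \<longrightarrow>
              (\<forall>s. (t, s) \<in> acc F \<longrightarrow> (\<forall>y\<in>dom_at F s. [y] \<in> V s ()))) \<longrightarrow>
           (\<forall>s. (u', s) \<in> acc F \<longrightarrow> (\<forall>y\<in>dom_at F s. [y] \<in> V s ())))) \<longrightarrow>
        (\<forall>s. (v, s) \<in> acc F \<longrightarrow> (\<forall>y\<in>dom_at F s. [y] \<in> V s ())))"
  by (simp add: casari_def Let_def)

text \<open>Casari's formula is closed and has no constants, so the single interpretation
  \<open>undefined\<close> represents all of them and no condition on the environment
  remains.\<close>

lemma Cas_iff:
  "F \<in> Cas \<longleftrightarrow> kripke_frame F \<and>
     (\<forall>V w e. kripke_model F {} (undefined :: unit \<Rightarrow> 'd) V \<longrightarrow> w \<in> worlds F \<longrightarrow>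
        forces F (undefined :: unit \<Rightarrow> 'd) V casari w e)" for F :: "('w, 'd) frame"
proof -
  have *: "constants_of ({} \<union> {casari}) = {}" "fv casari = {}"
    by (auto simp: constants_of_def casari_def Let_def)
  have "kripke_model F {} I V \<longleftrightarrow> kripke_model F {} (undefined :: unit \<Rightarrow> 'd) V"
    for I :: "unit \<Rightarrow> 'd" and V :: "'w \<Rightarrow> unit \<Rightarrow> 'd list set"
    by (simp add: kripke_model_def)
  moreover have "forces F I V casari w e \<longleftrightarrow> forces F (undefined :: unit \<Rightarrow> 'd) V casari w e"
    for I :: "unit \<Rightarrow> 'd" and V w e
    by (simp add: forces_casari)
  ultimately show ?thesis
    unfolding Cas_def valid_on_def consequence_def true_at_def * by simp blast
qed

text \<open>Induction from the later worlds down to \<open>u\<close>. Suppose P[y] fails at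
  \<open>u\<close> while \<forall>x P holds at all strictly later worlds. Then P[y]
  \<longrightarrow> \<forall>x P holds at \<open>u\<close>, because P[y] can hold only strictly
  later, and the antecedent of Casari's formula yields \<forall>x P at \<open>u\<close>, a
  contradiction.\<close>

lemma noetherian_Cas:
  assumes F: "kripke_frame F" and "noetherian F"
  shows "F \<in> Cas"
  unfolding Cas_iff
proof (intro conjI F allI impI)
  fix V :: "'a \<Rightarrow> unit \<Rightarrow> 'b list set" and w e
  let ?all = "\<lambda>u. \<forall>s. (u, s) \<in> acc F \<longrightarrow> (\<forall>y\<in>dom_at F s. [y] \<in> V s ())"
  have "?all v"
    if ant: "\<And>u x u'. (v, u) \<in> acc F \<Longrightarrow> x \<in> dom_at F u \<Longrightarrow> (u, u') \<in> acc F \<Longrightarrow>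
      (\<And>t. (u', t) \<in> acc F \<Longrightarrow> [x] \<in> V t () \<Longrightarrow> ?all t) \<Longrightarrow> ?all u'" for v
  proof -
    have "(v, u) \<in> acc F \<Longrightarrow> ?all u" for u
      using assms(2)[unfolded noetherian_def]
    proof (induction u rule: wf_induct_rule)
      case (less u)
      have above: "?all s" if "(u, s) \<in> acc F" "s \<noteq> u" for s
        using less that kripke_frameD(2)[OF F] by blast
      have u: "(u, u) \<in> acc F" using less.prems kripke_frameD[OF F] by blast
      have "[y] \<in> V u ()" if y: "y \<in> dom_at F u" for y
      proof (rule ccontr)
        assume neg: "[y] \<notin> V u ()"
        have "?all u" by (rule ant[OF less.prems y u]) (use above neg in blast)
        then show False using u y neg by blast
      qed
      then show ?case using above kripke_frameD[OF F] by blast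
    qed
    then show ?thesis using kripke_frameD[OF F] by blast
  qed
  then show "forces F (undefined :: unit \<Rightarrow> 'b) V casari w e"
    unfolding forces_casari by blast
qed

lemma ascending_mono:
  assumes "kripke_frame F" and "ascending F f" and "m \<le> n"
  shows "(f m, f n) \<in> acc F"
  using assms(3)
proof (induction n rule: dec_induct)
  case base
  then show ?case using assms kripke_frameD[OF assms(1)] unfolding ascending_def by blast
next
  case (step n)
  then show ?case using assms kripke_frameD(2)[OF assms(1)] unfolding ascending_def by blast
qed

lemma ascending_strict:
  assumes "kripke_frame F" and "ascending F f" and "m < n"
  shows "(f n, f m) \<notin> acc F"
proof
  assume "(f n, f m) \<in> acc F"
  moreover have "(f (Suc m), f n) \<in> acc F" by (rule ascending_mono) (use assms in auto)
  ultimately have "(f (Suc m), f m) \<in> acc F" using kripke_frameD(2)[OF assms(1)] by blast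
  then show False
    using assms(2) kripke_frameD(3)[OF assms(1)] unfolding ascending_def by blast
qed

text \<open>
  The refuting valuation makes \<open>P\<close> fail at worlds below the sequence exactly of those \<open>d k\<close>
  whose index is at least the least stage above that world.
\<close>

lemma Cas_no_injective_ascent:
  assumes "F \<in> Cas" and asc: "ascending F f" and "inj d" and d: "\<And>n. d n \<in> dom_at F (f n)"
  shows False
proof -
  have F: "kripke_frame F" using assms(1) by (simp add: Cas_def)
  note acc = kripke_frameD[OF F]
  define stage where "stage u = (LEAST n. (u, f n) \<in> acc F)" for u
  define below where "below u \<longleftrightarrow> (\<exists>n. (u, f n) \<in> acc F)" for u
  define V where "V u (p :: unit) =
      {[x] | x. x \<in> dom_at F u \<and> \<not> (below u \<and> (\<exists>k\<ge>stage u. x = d k))}" for u p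
  have stage_f: "stage (f n) = n" for n
    unfolding stage_def
    by (rule Least_equality) (use ascending_mono[OF F asc] ascending_strict[OF F asc] not_less in blast)+
  have below_f: "below (f n)" for n
    unfolding below_def using ascending_mono[OF F asc] by blast
  have below_mono: "below u" "stage u \<le> stage u'" if "(u, u') \<in> acc F" "below u'" for u u'
  proof -
    show "below u" using that acc(2) unfolding below_def by blast
    have "(u', f (stage u')) \<in> acc F"
      using that(2) unfolding below_def stage_def by (rule LeastI_ex)
    then show "stage u \<le> stage u'"
      unfolding stage_def[of u] using that acc(2) by (blast intro: Least_le)
  qed
  have "V u p \<subseteq> V u' p" if "(u, u') \<in> acc F" for u u' p
  proof
    fix z assume "z \<in> V u p"
    then obtain x where "z = [x]" "x \<in> dom_at F u" "\<not> (below u \<and> (\<exists>k\<ge>stage u. x = d k))"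
      unfolding V_def by blast
    moreover from this have "\<not> (below u' \<and> (\<exists>k\<ge>stage u'. x = d k))"
      using below_mono[OF that] le_trans by blast
    ultimately show "z \<in> V u' p" using acc(5)[OF that] unfolding V_def by blast
  qed
  moreover have "V u p \<subseteq> lists (dom_at F u)" for u p by (auto simp: V_def)
  ultimately have "kripke_model F {} (undefined :: unit \<Rightarrow> 'b) V"
    unfolding kripke_model_def using F by blast
  moreover have f0: "f 0 \<in> worlds F" using asc acc(4) unfolding ascending_def by blast
  ultimately have cas: "forces F (undefined :: unit \<Rightarrow> 'b) V casari (f 0) e" for e
    using assms(1) unfolding Cas_iff by blast
  define all where "all u \<longleftrightarrow> (\<forall>s. (u, s) \<in> acc F \<longrightarrow> (\<forall>y\<in>dom_at F s. [y] \<in> V s ()))" for u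
  have not_V: "[d n] \<notin> V (f n) ()" for n
    using below_f[of n] stage_f[of n] by (auto simp: V_def)
  have not_all: "\<not> all (f n)" for n
    using not_V d ascending_mono[OF F asc] unfolding all_def by blast
  \<comment> \<open>This is the antecedent of Casari's formula: wherever P[x] \<longrightarrow>
    \<forall>x P is forced for an individual \<open>x\<close> of the world, so is \<forall>x
    P.\<close>
  have all: "all u"
    if x: "x \<in> dom_at F u" and h: "\<And>t. (u, t) \<in> acc F \<Longrightarrow> [x] \<in> V t () \<Longrightarrow> all t" for u x
  proof (cases "below u")
    case True
    \<comment> \<open>\<open>m\<close> lies beyond the index of \<open>x\<close> in
      \<open>d\<close>, if \<open>x\<close> has one; otherwise the choice is arbitrary and harmless.
      So P[x] holds at \<open>f m\<close>, a world above \<open>u\<close>, while \<forall>x P fails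
      there, which contradicts \<open>h\<close>.\<close>
    define m where "m = max (stage u) (Suc (SOME k. x = d k))"
    have "(u, f (stage u)) \<in> acc F"
      using True unfolding below_def stage_def by (rule LeastI_ex)
    moreover have "(f (stage u), f m) \<in> acc F"
      by (rule ascending_mono[OF F asc]) (simp add: m_def)
    ultimately have um: "(u, f m) \<in> acc F" by (rule acc(2))
    have "x \<noteq> d k" if "k \<ge> m" for k
    proof
      assume "x = d k"
      then have "(SOME k. x = d k) = k" using \<open>inj d\<close> by (auto simp: inj_eq)
      then show False using that \<open>x = d k\<close> unfolding m_def by auto
    qed
    then have "[x] \<in> V (f m) ()"
      using x acc(5)[OF um] by (auto simp: V_def stage_f)
    then show ?thesis using h um not_all by blast
  next
    case False
    \<comment> \<open>No world above \<open>u\<close> lies below the sequence either, so P holds of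
      all individuals there.\<close>
    then show ?thesis using below_mono(1) by (auto simp: all_def V_def)
  qed
  have "all (f 0)" if "\<forall>u. (f 0, u) \<in> acc F \<longrightarrow> (\<forall>x\<in>dom_at F u. \<forall>u'. (u, u') \<in> acc F \<longrightarrow>
      (\<forall>t. (u', t) \<in> acc F \<longrightarrow> [x] \<in> V t () \<longrightarrow> all t) \<longrightarrow> all u')"
    using cas[unfolded forces_casari, rule_format, OF acc(1)[OF f0]] that unfolding all_def by blast
  then have "all (f 0)" using all acc(5) by blast
  then show False using not_all by blast
qed

text \<open>An infinite union contains a sequence of distinct individuals, but these may appear in
  any order. Passing to a sparse subsequence of worlds, whose \<open>k\<close>-th member comes after
  the appearance of the \<open>k\<close>-th individual, reduces this to the injective case.\<close>

lemma Cas_finite_ascents: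
  assumes "F \<in> Cas"
  shows "finite_ascents F"
  unfolding finite_ascents_def
proof (intro allI impI, rule ccontr)
  fix f assume asc: "ascending F f" and "infinite (\<Union>n. dom_at F (f n))"
  then obtain d :: "nat \<Rightarrow> 'b" where d: "inj d" "range d \<subseteq> (\<Union>n. dom_at F (f n))"
    by (auto dest: infinite_countable_subset)
  have F: "kripke_frame F" using assms by (simp add: Cas_def)
  obtain g where g: "\<And>k. d k \<in> dom_at F (f (g k))"
    using d(2) by (metis UN_E rangeI subsetD)
  \<comment> \<open>The summand \<open>k\<close> makes \<open>h\<close> strictly increasing; the sum
    makes it dominate \<open>g\<close>.\<close>
  define h where "h k = k + (\<Sum>i\<le>k. g i)" for k
  have "g k \<le> h k" for k
    unfolding h_def by (simp add: member_le_sum trans_le_add2)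
  then have "d k \<in> dom_at F (f (h k))" for k
    using g[of k] kripke_frameD(5)[OF F ascending_mono[OF F asc]] by blast
  moreover have "ascending F (f \<circ> h)"
  proof -
    have "h k < h (Suc k)" for k by (simp add: h_def)
    then show ?thesis
      using ascending_mono[OF F asc] ascending_strict[OF F asc] unfolding ascending_def
      by (metis comp_apply less_imp_le)
  qed
  ultimately show False using Cas_no_injective_ascent[OF assms _ d(1), of "f \<circ> h"] by simp
qed

section \<open>Countable elementary submodels\<close>

text \<open>A Skolem relation of one uniform shape for the three connectives whose forcing clauses
  quantify: counterexamples for \<longrightarrow> and \<forall>, instances for \<exists>. For
  \<open>Imp\<close> any \<open>d\<close> will do; for \<open>Ex\<close> the world stays
  \<open>w\<close>.\<close>

primrec witness ::
  "('w, 'd) frame \<Rightarrow> ('c \<Rightarrow> 'd) \<Rightarrow> ('w \<Rightarrow> 'p \<Rightarrow> 'd list set) \<Rightarrow>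
   ('p, 'c) fm \<Rightarrow> 'w \<Rightarrow> (nat \<Rightarrow> 'd) \<Rightarrow> 'w \<Rightarrow> 'd \<Rightarrow> bool" where
  "witness F I V Bot w e v d \<longleftrightarrow> False"
| "witness F I V (Atom p ts) w e v d \<longleftrightarrow> False"
| "witness F I V (Imp A B) w e v d \<longleftrightarrow>
     (w, v) \<in> acc F \<and> forces F I V A v e \<and> \<not> forces F I V B v e"
| "witness F I V (And A B) w e v d \<longleftrightarrow> False"
| "witness F I V (Or A B) w e v d \<longleftrightarrow> False"
| "witness F I V (All x A) w e v d \<longleftrightarrow>
     (w, v) \<in> acc F \<and> d \<in> dom_at F v \<and> \<not> forces F I V A v (e(x := d))"
| "witness F I V (Ex x A) w e v d \<longleftrightarrow>
     v = w \<and> d \<in> dom_at F w \<and> forces F I V A w (e(x := d))"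

text \<open>The Tarski-Vaught criterion, relative to the formulas in \<open>G\<close>.\<close>

definition elementary_hull ::
  "('w, 'd) frame \<Rightarrow> ('c \<Rightarrow> 'd) \<Rightarrow> ('w \<Rightarrow> 'p \<Rightarrow> 'd list set) \<Rightarrow>
   ('p, 'c) fm set \<Rightarrow> 'w set \<Rightarrow> 'd set \<Rightarrow> bool" where
  "elementary_hull F I V G W E \<longleftrightarrow> W \<subseteq> worlds F \<and>
     (\<forall>A\<in>G. \<forall>w\<in>W. \<forall>e. range e \<subseteq> E \<longrightarrow> (\<exists>v d. witness F I V A w e v d) \<longrightarrow>
        (\<exists>v\<in>W. \<exists>d\<in>E. witness F I V A w e v d))"

lemma witness_cong:
  assumes "\<And>x. x \<in> fv A \<Longrightarrow> e x = e' x"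
  shows "witness F I V A w e v d = witness F I V A w e' v d"
proof (cases A)
  case (Imp A1 A2)
  then show ?thesis using assms forces_cong[of A1 e e' F I V v] forces_cong[of A2 e e' F I V v] by auto
next
  case (All x B)
  then show ?thesis using assms forces_cong[of B "e(x := d)" "e'(x := d)" F I V v] by auto
next
  case (Ex x B)
  then show ?thesis using assms forces_cong[of B "e(x := d)" "e'(x := d)" F I V v] by auto
qed auto

text \<open>Downward Loewenheim-Skolem: \<open>w0\<close> and \<open>K\<close> are closed under
  chosen witnesses in countably many steps. There may be uncountably many environments, but only
  their values on finitely many variables matter, so finite lists padded with \<open>d0\<close>
  replace them.\<close>

lemma elementary_hull_exists:
  assumes F: "kripke_frame F" and G: "finite G" and w0: "w0 \<in> worlds F" and K: "countable K"
  obtains W E where "countable W" "countable E" "w0 \<in> W" "K \<subseteq> E" "E \<noteq> {}"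
    "elementary_hull F I V G W E"
proof -
  define d0 :: 'b where "d0 = undefined"
  define env where "env xs x = (if x < length xs then xs ! x else d0)" for xs and x :: nat
  define wit where "wit A w xs z \<longleftrightarrow> witness F I V A w (env xs) (fst z) (snd z)" for A w xs z
  define sk where "sk A w xs = (if \<exists>z. wit A w xs z then SOME z. wit A w xs z else (w0, d0))"
    for A w xs
  \<comment> \<open>Worlds and individuals are generated together as pairs; the hull consists of the
    two projections of \<open>Z\<close>.\<close>
  define step where "step Z = Z \<union> (\<lambda>(A, w, xs). sk A w xs) ` (G \<times> fst ` Z \<times> lists (snd ` Z))" for Z
  define Zs where "Zs n = (step ^^ n) ({w0} \<times> insert d0 K)" for n
  define Z where "Z = (\<Union>n. Zs n)"
  have sk: "wit A w xs (sk A w xs)" if "wit A w xs z" for A w xs z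
    unfolding sk_def using that someI[of "wit A w xs" z] by (simp only: if_P[OF exI, of "wit A w xs" z])
  have mono: "Zs m \<subseteq> Zs n" if "m \<le> n" for m n
    using that by (rule lift_Suc_mono_le[rotated]) (auto simp: Zs_def step_def)
  have "countable (Zs n)" for n
    by (induction n) (use K G in \<open>auto simp: Zs_def step_def countable_finite\<close>)
  then have countable: "countable Z" unfolding Z_def by blast
  have "fst ` Zs n \<subseteq> worlds F" for n
  proof (induction n)
    case 0
    then show ?case using w0 by (auto simp: Zs_def)
  next
    case (Suc n)
    have "fst (sk A w xs) \<in> worlds F" if "w \<in> worlds F" for A w xs
    proof (cases "\<exists>z. wit A w xs z")
      case True
      then have "wit A w xs (sk A w xs)" using sk by blast
      then show ?thesis
        unfolding wit_def using that kripke_frameD(4)[OF F] by (cases A) auto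
    next
      case False
      then show ?thesis using w0 by (simp add: sk_def)
    qed
    then show ?case using Suc by (auto simp: Zs_def step_def)
  qed
  then have worlds: "fst ` Z \<subseteq> worlds F" unfolding Z_def by blast
  have base: "{w0} \<times> insert d0 K \<subseteq> Z"
    unfolding Z_def using UN_upper[of 0 UNIV Zs] by (simp add: Zs_def)
  \<comment> \<open>A list has finitely many entries and the stages increase, so one stage contains
    them all.\<close>
  have lists: "\<exists>n. xs \<in> lists (snd ` Zs n)" if "xs \<in> lists (snd ` Z)" for xs
    using that
  proof (induction xs)
    case (Cons x xs)
    then obtain m n where "x \<in> snd ` Zs m" "xs \<in> lists (snd ` Zs n)"
      by (auto simp: Z_def image_UN)
    then have "x # xs \<in> lists (snd ` Zs (max m n))"
      using mono[of m "max m n"] lists_mono[OF image_mono[OF mono[of n "max m n"]], of snd] by auto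
    then show ?case by blast
  qed simp
  have closed: "sk A w xs \<in> Z" if "A \<in> G" and w: "w \<in> fst ` Z" and xs: "xs \<in> lists (snd ` Z)" for A w xs
  proof -
    obtain m n where mn: "w \<in> fst ` Zs m" "xs \<in> lists (snd ` Zs n)"
      using w lists[OF xs] by (auto simp: Z_def image_UN)
    let ?k = "max m n"
    have "w \<in> fst ` Zs ?k" using mn(1) mono[of m ?k] by auto
    moreover have "xs \<in> lists (snd ` Zs ?k)"
      using mn(2) lists_mono[OF image_mono[OF mono[of n ?k]], of snd] by auto
    ultimately have "sk A w xs \<in> step (Zs ?k)"
      unfolding step_def using that(1) by force
    then have "sk A w xs \<in> Zs (Suc ?k)" by (simp add: Zs_def)
    then show ?thesis unfolding Z_def by blast
  qed
  \<comment> \<open>\<open>N\<close> bounds the free variables in \<open>G\<close>, so cutting an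
    environment down to its first \<open>N\<close> values does not change the witnesses.\<close>
  have "finite (\<Union>A\<in>G. fv A)" using G finite_fv by blast
  then obtain N where N: "\<And>A x. A \<in> G \<Longrightarrow> x \<in> fv A \<Longrightarrow> x < N"
    unfolding finite_nat_set_iff_bounded by blast
  have "\<exists>v\<in>fst ` Z. \<exists>d\<in>snd ` Z. witness F I V A w e v d"
    if "A \<in> G" "w \<in> fst ` Z" "range e \<subseteq> snd ` Z" "witness F I V A w e v d" for A w e v d
  proof -
    let ?xs = "map e [0..<N]"
    have cong: "witness F I V A w e v d = witness F I V A w (env ?xs) v d" for v d
      by (rule witness_cong) (use N[OF that(1)] in \<open>simp add: env_def\<close>)
    have "e x \<in> snd ` Z" for x using that(3) by blast
    then have "?xs \<in> lists (snd ` Z)" by (simp add: in_lists_conv_set)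
    then have "sk A w ?xs \<in> Z" by (rule closed[OF that(1,2)])
    moreover have "wit A w ?xs (sk A w ?xs)"
      using sk[of A w ?xs "(v, d)"] that(4) by (simp add: wit_def cong)
    ultimately show ?thesis unfolding wit_def cong by blast
  qed
  then have "elementary_hull F I V G (fst ` Z) (snd ` Z)"
    unfolding elementary_hull_def using worlds by blast
  moreover have "w0 \<in> fst ` Z" "K \<subseteq> snd ` Z" "snd ` Z \<noteq> {}" using base by force+
  ultimately show ?thesis using that[of "fst ` Z" "snd ` Z"] countable by simp
qed

section \<open>Renamed copies of elementary submodels\<close>

definition pullback_frame ::
  "('w, 'd) frame \<Rightarrow> ('v \<Rightarrow> 'w) \<Rightarrow> ('e \<Rightarrow> 'd) \<Rightarrow> 'v set \<Rightarrow> 'e set \<Rightarrow> ('v, 'e) frame" where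
  "pullback_frame F \<pi> \<rho> W E =
     \<lparr>worlds = W, acc = {(w, v). w \<in> W \<and> v \<in> W \<and> (\<pi> w, \<pi> v) \<in> acc F},
      dom_at = (\<lambda>w. {d \<in> E. \<rho> d \<in> dom_at F (\<pi> w)})\<rparr>"

definition pullback_val ::
  "('w \<Rightarrow> 'p \<Rightarrow> 'd list set) \<Rightarrow> ('v \<Rightarrow> 'w) \<Rightarrow> ('e \<Rightarrow> 'd) \<Rightarrow> 'e set \<Rightarrow> 'v \<Rightarrow> 'p \<Rightarrow> 'e list set" where
  "pullback_val V \<pi> \<rho> E w p = {ds \<in> lists E. map \<rho> ds \<in> V (\<pi> w) p}"

text \<open>Injectivity of \<open>\<pi>\<close> gives antisymmetry of the copy;
  \<open>\<rho>\<close> may map several names to one individual.\<close>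

lemma pullback_model:
  assumes M: "kripke_model F K I V" and \<pi>: "\<pi> ` W2 \<subseteq> worlds F" "inj_on \<pi> W2"
    and I2: "\<And>c. c \<in> K \<Longrightarrow> I2 c \<in> E2 \<and> \<rho> (I2 c) = I c"
  shows "kripke_model (pullback_frame F \<pi> \<rho> W2 E2) K I2 (pullback_val V \<pi> \<rho> E2)"
proof -
  note F = kripke_frameD[OF kripke_modelD(1)[OF M]]
  let ?F = "pullback_frame F \<pi> \<rho> W2 E2"
  have "kripke_frame ?F"
    unfolding kripke_frame_def partial_order_on_def preorder_on_def
  proof (intro conjI)
    show "antisym (acc ?F)"
      by (rule antisymI) (use inj_onD[OF \<pi>(2)] F(3) in \<open>auto simp: pullback_frame_def\<close>)
    show "trans (acc ?F)"
      by (rule transI) (use F(2) in \<open>auto simp: pullback_frame_def\<close>)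
    show "\<forall>(w, v)\<in>acc ?F. dom_at ?F w \<subseteq> dom_at ?F v"
      using F(5) by (auto simp: pullback_frame_def)
  qed (use \<pi>(1) F(1) in \<open>auto simp: pullback_frame_def refl_on_def\<close>)
  moreover have "pullback_val V \<pi> \<rho> E2 w p \<subseteq> lists {d \<in> E2. \<rho> d \<in> dom_at F (\<pi> w)}"
    if "w \<in> W2" for w p
    using kripke_modelD(3)[OF M, of "\<pi> w" p] that \<pi>(1)
    by (force simp: pullback_val_def in_lists_conv_set subset_iff)
  moreover have "pullback_val V \<pi> \<rho> E2 w p \<subseteq> pullback_val V \<pi> \<rho> E2 v p"
    if "(\<pi> w, \<pi> v) \<in> acc F" for w v p
    using kripke_modelD(4)[OF M that, of p] by (auto simp: pullback_val_def)
  ultimately show ?thesis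
    using I2 kripke_modelD(2)[OF M] \<pi>(1)
    by (auto simp: kripke_model_def pullback_frame_def image_subset_iff)
qed

text \<open>The Tarski-Vaught argument: a counterexample or instance in the large model is moved
  into the hull by \<open>reflect\<close> and so has a name in the copy.\<close>

lemma forces_pullback:
  fixes \<rho> :: "'e \<Rightarrow> 'd"
  assumes M: "kripke_model F K I V" and hull: "elementary_hull F I V G (\<pi> ` W2) (\<rho> ` E2)"
    and I2: "\<And>c. c \<in> K \<Longrightarrow> I2 c \<in> E2 \<and> \<rho> (I2 c) = I c"
    and "subfms A \<subseteq> G" and "consts_fm A \<subseteq> K" and "w \<in> W2" and "range e \<subseteq> E2"
  shows "forces (pullback_frame F \<pi> \<rho> W2 E2) I2 (pullback_val V \<pi> \<rho> E2) A w e \<longleftrightarrow>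
         forces F I V A (\<pi> w) (\<lambda>y. \<rho> (e y))"
proof -
  have upd: "(\<lambda>y. \<rho> ((e(x := d)) y)) = (\<lambda>y. \<rho> (e y))(x := \<rho> d)" for e :: "nat \<Rightarrow> 'e" and x d
    by auto
  have reflect: "\<exists>v\<in>W2. \<exists>d\<in>E2. witness F I V A (\<pi> w) (\<lambda>y. \<rho> (e y)) (\<pi> v) (\<rho> d)"
    if "A \<in> G" "w \<in> W2" "range e \<subseteq> E2" "witness F I V A (\<pi> w) (\<lambda>y. \<rho> (e y)) v d" for A w e v d
  proof -
    have "range (\<lambda>y. \<rho> (e y)) \<subseteq> \<rho> ` E2" using that(3) by auto
    then have "\<exists>v\<in>\<pi> ` W2. \<exists>d\<in>\<rho> ` E2. witness F I V A (\<pi> w) (\<lambda>y. \<rho> (e y)) v d"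
      using hull[unfolded elementary_hull_def, THEN conjunct2, rule_format, OF that(1) imageI[OF that(2)]]
        that(4) by metis
    then show ?thesis by blast
  qed
  show ?thesis
    using assms(4-7)
  proof (induction A arbitrary: w e)
    case (Atom p ts)
    have "tm_val I2 e t \<in> E2 \<and> \<rho> (tm_val I2 e t) = tm_val I (\<lambda>y. \<rho> (e y)) t" if "t \<in> set ts" for t
      by (cases t) (use that Atom.prems I2 in \<open>force simp: subset_iff\<close>)+
    then have "map (tm_val I2 e) ts \<in> lists E2"
      "map \<rho> (map (tm_val I2 e) ts) = map (tm_val I (\<lambda>y. \<rho> (e y))) ts" by auto
    then show ?case by (simp only: forces.simps pullback_val_def mem_Collect_eq simp_thms)
  next
    case (Imp A B)
    have IH: "forces (pullback_frame F \<pi> \<rho> W2 E2) I2 (pullback_val V \<pi> \<rho> E2) A v e =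
        forces F I V A (\<pi> v) (\<lambda>y. \<rho> (e y))"
      "forces (pullback_frame F \<pi> \<rho> W2 E2) I2 (pullback_val V \<pi> \<rho> E2) B v e =
        forces F I V B (\<pi> v) (\<lambda>y. \<rho> (e y))" if "v \<in> W2" for v
      using Imp that by auto
    have "Imp A B \<in> G" using Imp.prems(1) by simp
    from reflect[OF this Imp.prems(3,4)] show ?case
      using IH Imp.prems(3) by (fastforce simp: pullback_frame_def)
  next
    case (All x A)
    have IH: "forces (pullback_frame F \<pi> \<rho> W2 E2) I2 (pullback_val V \<pi> \<rho> E2) A v (e(x := d)) =
        forces F I V A (\<pi> v) ((\<lambda>y. \<rho> (e y))(x := \<rho> d))" if "v \<in> W2" "d \<in> E2" for v d
      unfolding upd[symmetric]
      by (rule All.IH) (use All.prems that in \<open>auto simp: image_subset_iff\<close>)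
    have "All x A \<in> G" using All.prems(1) by simp
    from reflect[OF this All.prems(3,4)] show ?case
      using IH All.prems(3) by (fastforce simp: pullback_frame_def)
  next
    case (Ex x A)
    have IH: "forces (pullback_frame F \<pi> \<rho> W2 E2) I2 (pullback_val V \<pi> \<rho> E2) A v (e(x := d)) =
        forces F I V A (\<pi> v) ((\<lambda>y. \<rho> (e y))(x := \<rho> d))" if "v \<in> W2" "d \<in> E2" for v d
      unfolding upd[symmetric]
      by (rule Ex.IH) (use Ex.prems that in \<open>auto simp: image_subset_iff\<close>)
    have "Ex x A \<in> G" using Ex.prems(1) by simp
    from reflect[OF this Ex.prems(3,4)] show ?case
      using IH Ex.prems(3) by (fastforce simp: pullback_frame_def)
  qed auto
qed

section \<open>Countermodels and their transfer between types\<close>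

definition countermodel ::
  "('w, 'd) frame \<Rightarrow> 'c set \<Rightarrow> ('c \<Rightarrow> 'd) \<Rightarrow> ('w \<Rightarrow> 'p \<Rightarrow> 'd list set) \<Rightarrow>
   ('p, 'c) fm set \<Rightarrow> ('p, 'c) fm set \<Rightarrow> bool" where
  "countermodel F K I V T S \<longleftrightarrow> kripke_model F K I V \<and>
     (\<forall>w\<in>worlds F. \<forall>A\<in>T. \<forall>e. forces F I V A w e) \<and>
     (\<exists>w\<in>worlds F. \<exists>A\<in>S. \<exists>e. \<not> forces F I V A w e)"

text \<open>For closed formulas the restriction on environments in \<open>true_at\<close> is
  vacuous, so a countermodel may quantify over all environments.\<close>

lemma not_consequence_iff:
  assumes "\<forall>A\<in>T. fv A = {}" and "fv \<phi> = {}"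
  shows "\<not> consequence X T \<phi> \<longleftrightarrow>
    (\<exists>F\<in>X. \<exists>I V. countermodel F (constants_of (T \<union> {\<phi>})) I V T {\<phi>})"
  using assms unfolding consequence_def countermodel_def true_at_def by (simp; blast)

text \<open>\<open>forces_pullback\<close> speaks only of environments with values in
  \<open>E2\<close>. The formulas are closed, so every environment can be exchanged for a constant
  one with a value from the nonempty set \<open>E2\<close>.\<close>

lemma countermodel_pullback:
  assumes M: "countermodel F K I V T {\<phi>}" and closed: "\<forall>A\<in>T. fv A = {}" "fv \<phi> = {}"
    and K: "constants_of (T \<union> {\<phi>}) \<subseteq> K"
    and hull: "elementary_hull F I V (\<Union>A\<in>T \<union> {\<phi>}. subfms A) (\<pi> ` W2) (\<rho> ` E2)"
    and inj: "inj_on \<pi> W2" and E2: "E2 \<noteq> {}"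
    and I2: "\<And>c. c \<in> K \<Longrightarrow> I2 c \<in> E2 \<and> \<rho> (I2 c) = I c"
    and w0: "w0 \<in> \<pi> ` W2" "\<not> forces F I V \<phi> w0 e0"
  shows "countermodel (pullback_frame F \<pi> \<rho> W2 E2) K I2 (pullback_val V \<pi> \<rho> E2) T {\<phi>}"
proof -
  let ?F = "pullback_frame F \<pi> \<rho> W2 E2" and ?V = "pullback_val V \<pi> \<rho> E2"
  have model: "kripke_model F K I V" using M by (simp add: countermodel_def)
  have sub: "\<pi> ` W2 \<subseteq> worlds F" using hull by (simp add: elementary_hull_def)
  have eq: "forces ?F I2 ?V A w e \<longleftrightarrow> forces F I V A (\<pi> w) e'"
    if "A \<in> T \<union> {\<phi>}" "w \<in> W2" for A w e e'
  proof -
    obtain d where d: "d \<in> E2" using E2 by blast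
    have "fv A = {}" using that closed by auto
    then have "forces ?F I2 ?V A w e \<longleftrightarrow> forces ?F I2 ?V A w (\<lambda>_. d)"
      "forces F I V A (\<pi> w) e' \<longleftrightarrow> forces F I V A (\<pi> w) (\<lambda>y. \<rho> d)"
      by (auto intro!: forces_cong)
    moreover have "subfms A \<subseteq> (\<Union>A\<in>T \<union> {\<phi>}. subfms A)" "consts_fm A \<subseteq> K"
      using that K by (auto simp: constants_of_def)
    ultimately show ?thesis
      using forces_pullback[OF model hull I2, of A w "\<lambda>_. d"] d that(2) by auto
  qed
  have worlds: "worlds ?F = W2" by (simp add: pullback_frame_def)
  show ?thesis
    unfolding countermodel_def worlds
  proof (intro conjI ballI allI)
    show "kripke_model ?F K I2 ?V" by (rule pullback_model) (use model sub inj I2 in auto)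
    show "forces ?F I2 ?V A w e" if "w \<in> W2" "A \<in> T" for w A e
      using eq[of A w e undefined] that M sub unfolding countermodel_def by blast
    show "\<exists>w\<in>W2. \<exists>A\<in>{\<phi>}. \<exists>e. \<not> forces ?F I2 ?V A w e"
      using w0 eq[of \<phi> _ undefined e0] by blast
  qed
qed

lemma countable_hull_of_countermodel:
  fixes F :: "('w, 'd) frame"
  assumes "countermodel F K I V T {\<phi>}" and "finite T" and "finite K"
  obtains W E w0 e0 where "countable W" "countable E" "w0 \<in> W" "I ` K \<subseteq> E" "E \<noteq> {}"
    "elementary_hull F I V (\<Union>A\<in>T \<union> {\<phi>}. subfms A) W E" "\<not> forces F I V \<phi> w0 e0"
proof -
  obtain w0 e0 where w0: "w0 \<in> worlds F" "\<not> forces F I V \<phi> w0 e0"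
    using assms(1) unfolding countermodel_def by blast
  have F: "kripke_frame F" using assms(1) by (simp add: countermodel_def kripke_model_def)
  have "finite (\<Union>A\<in>T \<union> {\<phi>}. subfms A)" "countable (I ` K)"
    using assms(2,3) finite_subfms by (auto simp: countable_finite)
  from elementary_hull_exists[OF F this(1) w0(1) this(2), of I V] show ?thesis
    using that w0(2) by metis
qed

lemma countable_inj_on_into:
  assumes "countable A" and "infinite B"
  obtains f where "inj_on f A" and "f ` A \<subseteq> B"
proof -
  obtain g :: "nat \<Rightarrow> 'b" where g: "inj g" "range g \<subseteq> B"
    using infinite_countable_subset[OF assms(2)] by blast
  have "inj_on (g \<circ> to_nat_on A) A"
    using inj_on_to_nat_on[OF assms(1)] g(1) by (simp add: comp_inj_on inj_on_def)
  then show ?thesis using that[of "g \<circ> to_nat_on A"] g(2) by auto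
qed

text \<open>Opponent will bring the individuals into the game as new objects, so they must become
  objects of the language, with each constant denoting itself.\<close>

lemma countermodel_over_constants:
  fixes F :: "('w, 'd) frame" and \<phi> :: "('p, 'c) fm"
  assumes M: "countermodel F K I V T {\<phi>}" and "finite_ascents F" and "finite T"
    and closed: "\<forall>A\<in>T. fv A = {}" "fv \<phi> = {}" and K: "K = constants_of (T \<union> {\<phi>})"
    and "infinite (UNIV :: 'c set)"
  obtains F2 :: "('w, 'c) frame" and V2
  where "countermodel F2 K (\<lambda>c. c) V2 T {\<phi>}" and "finite_ascents F2"
proof -
  have "finite K" unfolding K constants_of_def using \<open>finite T\<close> finite_consts_fm by blast
  then obtain W E w0 e0 where hull: "countable W" "countable E" "w0 \<in> W" "I ` K \<subseteq> E" "E \<noteq> {}"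
    "elementary_hull F I V (\<Union>A\<in>T \<union> {\<phi>}. subfms A) W E" "\<not> forces F I V \<phi> w0 e0"
    using countable_hull_of_countermodel[OF M \<open>finite T\<close>] by metis
  have "infinite (- K)" using assms(7) \<open>finite K\<close> by (simp add: finite_compl)
  then obtain nm where nm: "inj_on nm E" "nm ` E \<subseteq> - K"
    using countable_inj_on_into[OF hull(2)] by metis
  \<comment> \<open>Constants keep their denotations, which several may share; every individual of
    \<open>E\<close> also has a fresh name outside \<open>K\<close>.\<close>
  define \<rho> where "\<rho> c = (if c \<in> K then I c else inv_into E nm c)" for c
  define E2 where "E2 = K \<union> nm ` E"
  have \<rho>: "\<rho> (nm d) = d" if "d \<in> E" for d
    using that nm by (auto simp: \<rho>_def inv_into_f_f)
  have \<rho>_E2: "\<rho> ` E2 = E"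
  proof
    show "\<rho> ` E2 \<subseteq> E" using \<rho> hull(4) by (auto simp: E2_def) (auto simp: \<rho>_def)
    show "E \<subseteq> \<rho> ` E2" using \<rho> by (force simp: E2_def)
  qed
  let ?F = "pullback_frame F (\<lambda>w. w) \<rho> W E2"
  have "countermodel ?F K (\<lambda>c. c) (pullback_val V (\<lambda>w. w) \<rho> E2) T {\<phi>}"
    by (rule countermodel_pullback[OF M closed, of _ _ _ _ _ w0 e0])
      (use hull \<rho>_E2 K in \<open>auto simp: E2_def \<rho>_def\<close>)
  moreover have "finite_ascents ?F"
    unfolding finite_ascents_def
  proof (intro allI impI)
    fix f assume "ascending ?F f"
    then have "ascending F f" by (simp add: ascending_def pullback_frame_def)
    then have fin: "finite (\<Union>n. dom_at F (f n))"
      using assms(2) by (simp add: finite_ascents_def)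
    \<comment> \<open>Apart from the finitely many constants, each individual has just one name, so
      finiteness of the union survives the renaming.\<close>
    have "(\<Union>n. dom_at ?F (f n)) \<subseteq> K \<union> nm ` (\<Union>n. dom_at F (f n))"
      using \<rho> by (fastforce simp: pullback_frame_def E2_def)
    then show "finite (\<Union>n. dom_at ?F (f n))"
      by (rule finite_subset) (use \<open>finite K\<close> fin in blast)
  qed
  ultimately show ?thesis using that by blast
qed

text \<open>The countable hull is renamed along injections into the infinite target types. A
  strictly ascending sequence of the copy is mapped back to one of \<open>F\<close>.\<close>

lemma countermodel_transfer:
  fixes F :: "('v, 'e) frame" and \<phi> :: "('p, 'c) fm"
  assumes M: "countermodel F K I V T {\<phi>}" and "noetherian F" and "finite T"
    and closed: "\<forall>A\<in>T. fv A = {}" "fv \<phi> = {}" and K: "K = constants_of (T \<union> {\<phi>})"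
    and "infinite (UNIV :: 'w set)" and "infinite (UNIV :: 'd set)"
  obtains F2 :: "('w, 'd) frame" and I2 V2
  where "countermodel F2 K I2 V2 T {\<phi>}" and "noetherian F2"
proof -
  have "finite K" unfolding K constants_of_def using \<open>finite T\<close> finite_consts_fm by blast
  then obtain W E w0 e0 where hull: "countable W" "countable E" "w0 \<in> W" "I ` K \<subseteq> E" "E \<noteq> {}"
    "elementary_hull F I V (\<Union>A\<in>T \<union> {\<phi>}. subfms A) W E" "\<not> forces F I V \<phi> w0 e0"
    using countable_hull_of_countermodel[OF M \<open>finite T\<close>] by metis
  obtain g :: "'v \<Rightarrow> 'w" where g: "inj_on g W"
    using countable_inj_on_into[OF hull(1) assms(7)] by metis
  obtain k :: "'e \<Rightarrow> 'd" where k: "inj_on k E"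
    using countable_inj_on_into[OF hull(2) assms(8)] by metis
  let ?\<pi> = "inv_into W g" and ?\<rho> = "inv_into E k"
  let ?F = "pullback_frame F ?\<pi> ?\<rho> (g ` W) (k ` E)"
  have \<pi>: "inj_on ?\<pi> (g ` W)" by (rule inj_on_inv_into) simp
  have images: "?\<pi> ` g ` W = W" "?\<rho> ` k ` E = E"
    using g k by (simp_all add: inv_into_image_cancel)
  have "countermodel ?F K (k \<circ> I) (pullback_val V ?\<pi> ?\<rho> (k ` E)) T {\<phi>}"
    by (rule countermodel_pullback[OF M closed, of _ _ _ _ _ w0 e0])
      (use hull images \<pi> k K in \<open>auto simp: inv_into_f_f image_subset_iff\<close>)
  moreover have "ascending F (?\<pi> \<circ> f)" if "ascending ?F f" for f
  proof -
    have "f n \<in> g ` W" for n using that by (simp add: ascending_def pullback_frame_def)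
    then have "?\<pi> (f n) = ?\<pi> (f (Suc n)) \<Longrightarrow> f n = f (Suc n)" for n
      using inj_onD[OF \<pi>] by blast
    then show ?thesis using that by (auto simp: ascending_def pullback_frame_def)
  qed
  then have "noetherian ?F" using assms(2) unfolding noetherian_iff by blast
  ultimately show ?thesis using that by blast
qed

section \<open>Playing against a winning region\<close>

text \<open>What Opponent asserts when he plays the world \<open>w\<close>. The members are closed,
  so one fixed environment stands for all.\<close>

definition forced_fms ::
  "('w, 'c) frame \<Rightarrow> ('w \<Rightarrow> 'p \<Rightarrow> 'c list set) \<Rightarrow> ('p, 'c) fm set \<Rightarrow> 'w \<Rightarrow> ('p, 'c) fm set" where
  "forced_fms F V G w =
     {A \<in> inst_fms G (dom_at F w). forces F (\<lambda>c. c) V A w (\<lambda>_. undefined)}"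

lemma forced_fms_mono:
  assumes "kripke_model F K (\<lambda>c. c) V" and "(w, v) \<in> acc F"
  shows "forced_fms F V G w \<subseteq> forced_fms F V G v"
  using forces_mono[OF assms] inst_fms_mono[OF kripke_frameD(5)[OF kripke_modelD(1)[OF assms(1)] assms(2)]]
  unfolding forced_fms_def by blast

lemma no_ascending_chain_in_finite_set:
  fixes g :: "nat \<Rightarrow> 'a set"
  assumes "finite S" and "\<And>n. g n \<subseteq> S" and "\<And>n. g n \<subset> g (Suc n)"
  shows False
proof -
  have "n \<le> card (g n)" for n
  proof (induction n)
    case (Suc n)
    have "card (g n) < card (g (Suc n))"
      by (rule psubset_card_mono[OF finite_subset[OF assms(2,1)] assms(3)])
    then show ?case using Suc by simp
  qed simp
  then have "Suc (card S) \<le> card (g (Suc (card S)))" .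
  also have "\<dots> \<le> card S" using assms by (intro card_mono) auto
  finally show False by simp
qed

text \<open>Worlds may ascend forever, but the pair of domain and forced formulas cannot keep
  changing: along an ascent the domains stay inside a finite set, and with them the available
  formulas.\<close>

lemma wf_forced_fms:
  fixes F :: "('a, 'c) frame"
  assumes M: "kripke_model F K (\<lambda>c. c) V" and "finite_ascents F" and "finite G"
  shows "wf {(u, w). (w, u) \<in> acc F \<and>
    (dom_at F u, forced_fms F V G u) \<noteq> (dom_at F w, forced_fms F V G w)}"
  unfolding wf_iff_no_infinite_down_chain
proof clarify
  fix f :: "nat \<Rightarrow> 'a"
  \<comment> \<open>The disjoint sum packs the pair into one set, which grows strictly inside a
    finite set.\<close>
  let ?g = "\<lambda>n. dom_at F (f n) <+> forced_fms F V G (f n)"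
  assume "\<forall>i. (f (Suc i), f i) \<in> {(u, w). (w, u) \<in> acc F \<and>
    (dom_at F u, forced_fms F V G u) \<noteq> (dom_at F w, forced_fms F V G w)}"
  then have step: "(f i, f (Suc i)) \<in> acc F"
    "(dom_at F (f (Suc i)), forced_fms F V G (f (Suc i))) \<noteq> (dom_at F (f i), forced_fms F V G (f i))"
    for i by blast+
  then have "ascending F f" unfolding ascending_def by metis
  then have fin: "finite (\<Union>n. dom_at F (f n))"
    using assms(2) by (simp add: finite_ascents_def)
  let ?D = "\<Union>n. dom_at F (f n)"
  show False
  proof (rule no_ascending_chain_in_finite_set)
    show "finite (?D <+> inst_fms G ?D)" using fin finite_inst_fms[OF assms(3) fin] by (rule finite_Plus)
    show "?g n \<subseteq> ?D <+> inst_fms G ?D" for n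
    proof -
      have "inst_fms G (dom_at F (f n)) \<subseteq> inst_fms G ?D" by (rule inst_fms_mono) blast
      then show ?thesis unfolding forced_fms_def by blast
    qed
    have "dom_at F (f n) \<subseteq> dom_at F (f (Suc n))" "forced_fms F V G (f n) \<subseteq> forced_fms F V G (f (Suc n))" for n
      by (rule kripke_frameD(5)[OF kripke_modelD(1)[OF M] step(1)]) (rule forced_fms_mono[OF M step(1)])
    then show "?g n \<subset> ?g (Suc n)" for n
      using step(2)[of n] unfolding Plus_def by blast
  qed
qed

text \<open>A formula of \<open>P\<close> can fail only at later worlds that look like
  \<open>v\<close>. A counterexample found there to an implication or a universal formula is already
  one at \<open>v\<close>, so the classical reading in the position agrees with forcing. Hence
  Opponent has no mistakes, while \<open>B\<close> is one of Proponent.\<close>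

lemma proponent_to_move_at_stable_world:
  fixes F V G v P
  defines "C \<equiv> \<lparr>opp = forced_fms F V G v, pro = P, objs = dom_at F v\<rparr>"
  assumes M: "kripke_model F K (\<lambda>c. c) V" and v: "v \<in> worlds F"
    and P: "P \<subseteq> inst_fms G (dom_at F v)"
    and B: "B \<in> P" "\<not> forces F (\<lambda>c. c) V B v (\<lambda>_. undefined)"
    and stable: "\<And>u A. (v, u) \<in> acc F \<Longrightarrow> A \<in> P \<Longrightarrow> \<not> forces F (\<lambda>c. c) V A u (\<lambda>_. undefined) \<Longrightarrow>
      dom_at F u = dom_at F v \<and> forced_fms F V G u = forced_fms F V G v"
  shows "to_move C = Proponent"
proof -
  let ?f = "\<lambda>A w. forces F (\<lambda>c. c) V A w (\<lambda>_. undefined)"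
  have F: "kripke_frame F" by (rule kripke_modelD(1)[OF M])
  have C: "opp C = forced_fms F V G v" "pro C = P" "objs C = dom_at F v"
    by (simp_all add: C_def)
  have transfer: "?f X u \<longleftrightarrow> ?f X v"
    if "(v, u) \<in> acc F" "A \<in> P" "\<not> ?f A u" "X \<in> inst_fms G (dom_at F v)" for u A X
  proof -
    have "X \<in> forced_fms F V G u \<longleftrightarrow> X \<in> forced_fms F V G v" "dom_at F u = dom_at F v"
      using stable[OF that(1-3)] by auto
    then show ?thesis using that(4) by (simp add: forced_fms_def)
  qed
  have holds: "holds C A \<longleftrightarrow> ?f A v" if "A \<in> inst_fms G (dom_at F v)" for A
  proof (rule holds_iff_forces[OF F v C(3)])
    show "A \<in> inst_fms G (objs C)" using that C by simp
    show "?f (Atom p ts) v \<longleftrightarrow> Atom p ts \<in> opp C" if "Atom p ts \<in> inst_fms G (objs C)" for p ts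
      using that C by (simp add: forced_fms_def)
    show "A \<in> opp C \<union> pro C" if "A \<in> inst_fms G (objs C)" "?f A v" for A
      using that C by (simp add: forced_fms_def)
    show "?f (Imp A B) v"
      if mem: "Imp A B \<in> inst_fms G (objs C)" "Imp A B \<in> opp C \<union> pro C"
        and AB: "?f A v \<Longrightarrow> ?f B v" for A B
    proof (rule ccontr)
      assume not: "\<not> ?f (Imp A B) v"
      then have "Imp A B \<in> P" using mem C by (auto simp: forced_fms_def)
      obtain u where u: "(v, u) \<in> acc F" "?f A u" "\<not> ?f B u" using not by auto
      \<comment> \<open>By reflexivity the implication fails at \<open>u\<close> itself, so
        stability applies to \<open>u\<close>.\<close>
      moreover have "(u, u) \<in> acc F" using kripke_frameD(1,4)[OF F] u(1) by blast
      ultimately have "\<not> ?f (Imp A B) u" by auto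
      moreover have "A \<in> inst_fms G (dom_at F v)" "B \<in> inst_fms G (dom_at F v)"
        using inst_fms_binary[of Imp A B] mem(1) C by auto
      ultimately show False
        using transfer[OF u(1) \<open>Imp A B \<in> P\<close>] u AB by blast
    qed
    show "?f (All x A) v"
      if mem: "All x A \<in> inst_fms G (objs C)" "All x A \<in> opp C \<union> pro C"
        and A: "\<And>a. a \<in> dom_at F v \<Longrightarrow> forces F (\<lambda>c. c) V A v ((\<lambda>_. undefined)(x := a))" for x A
    proof (rule ccontr)
      assume not: "\<not> ?f (All x A) v"
      then have inP: "All x A \<in> P" using mem C by (auto simp: forced_fms_def)
      obtain u a where u: "(v, u) \<in> acc F" "a \<in> dom_at F u" "\<not> ?f (inst [x \<mapsto> a] A) u"
        using not by (auto simp: forces_inst_single)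
      moreover have "(u, u) \<in> acc F" using kripke_frameD(1,4)[OF F] u(1) by blast
      ultimately have notu: "\<not> ?f (All x A) u" by (auto simp: forces_inst_single)
      then have a: "a \<in> dom_at F v" using stable[OF u(1) inP] u(2) by simp
      then have "inst [x \<mapsto> a] A \<in> inst_fms G (dom_at F v)"
        using inst_fms_quantifier[of All x A] mem(1) C by simp
      then have "?f (inst [x \<mapsto> a] A) u \<longleftrightarrow> ?f (inst [x \<mapsto> a] A) v"
        by (rule transfer[OF u(1) inP notu])
      then show False using u(3) A[OF a] by (simp add: forces_inst_single)
    qed
  qed
  have "mistakes Opponent C = {}"
    using holds by (auto simp: C forced_fms_def)
  moreover have "B \<in> mistakes Proponent C" using holds P B by (auto simp: C)
  ultimately show ?thesis unfolding to_move_def by auto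
qed

text \<open>Opponent moves to a stable world and the region supplies Proponent's answer. Since
  Proponent can only add formulas, one refuted at \<open>v\<close> remains in \<open>P\<close>, and
  the step can be repeated from \<open>v\<close>.\<close>

lemma opponent_step:
  assumes R: "winning_region G R" and M: "kripke_model F K (\<lambda>c. c) V"
    and asc: "finite_ascents F" and G: "finite G" and w: "w \<in> worlds F"
    and C: "C \<in> R" "to_move C = Opponent" "objs C \<subseteq> dom_at F w" "opp C \<subseteq> forced_fms F V G w"
      "pro C \<subseteq> inst_fms G (objs C)"
    and B: "B \<in> pro C" "\<not> forces F (\<lambda>c. c) V B w (\<lambda>_. undefined)"
  obtains v P where "(w, v) \<in> acc F"
    "to_move \<lparr>opp = forced_fms F V G v, pro = pro C, objs = dom_at F v\<rparr> = Proponent"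
    "\<lparr>opp = forced_fms F V G v, pro = P, objs = dom_at F v\<rparr> \<in> R"
    "to_move \<lparr>opp = forced_fms F V G v, pro = P, objs = dom_at F v\<rparr> = Opponent"
    "P \<subseteq> inst_fms G (dom_at F v)"
    "\<exists>B\<in>P. \<not> forces F (\<lambda>c. c) V B v (\<lambda>_. undefined)"
proof -
  have F: "kripke_frame F" by (rule kripke_modelD(1)[OF M])
  let ?f = "\<lambda>A w. forces F (\<lambda>c. c) V A w (\<lambda>_. undefined)"
  let ?Q = "{u. (w, u) \<in> acc F \<and> (\<exists>B\<in>pro C. \<not> ?f B u)}"
  have "w \<in> ?Q" using w B kripke_frameD(1)[OF F] by blast
  \<comment> \<open>By minimality, every world above \<open>v\<close> that still refutes a formula
    of Proponent has the domain and the forced formulas of \<open>v\<close>.\<close>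
  then obtain v where v: "v \<in> ?Q" and min: "\<And>u. (u, v) \<in> {(u, w). (w, u) \<in> acc F \<and>
    (dom_at F u, forced_fms F V G u) \<noteq> (dom_at F w, forced_fms F V G w)} \<Longrightarrow> u \<notin> ?Q"
    by (rule wfE_min[OF wf_forced_fms[OF M asc G]]) blast
  have stable: "dom_at F u = dom_at F v \<and> forced_fms F V G u = forced_fms F V G v"
    if "(v, u) \<in> acc F" "A \<in> pro C" "\<not> ?f A u" for u A
    using min[of u] that v kripke_frameD(2)[OF F] by blast
  have wv: "(w, v) \<in> acc F" and vw: "v \<in> worlds F" using v kripke_frameD(4)[OF F] by blast+
  have dom: "objs C \<subseteq> dom_at F v" using C(3) kripke_frameD(5)[OF F wv] by blast
  have pro: "pro C \<subseteq> inst_fms G (dom_at F v)" using C(5) inst_fms_mono[OF dom] by blast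
  let ?C = "\<lparr>opp = forced_fms F V G v, pro = pro C, objs = dom_at F v\<rparr>"
  have tm: "to_move ?C = Proponent"
  proof -
    obtain B' where B': "B' \<in> pro C" "\<not> ?f B' v" using v by blast
    show ?thesis by (rule proponent_to_move_at_stable_world[OF M vw pro B']) (rule stable)
  qed
  have "move Opponent G C ?C"
    unfolding move.simps
  proof (intro exI conjI)
    show "objs C \<subseteq> dom_at F v" by (rule dom)
    show "forced_fms F V G v \<subseteq> inst_fms G (dom_at F v)" by (auto simp: forced_fms_def)
    have "opp C \<union> forced_fms F V G v = forced_fms F V G v"
      using C(4) forced_fms_mono[OF M wv] by blast
    then show "?C = C\<lparr>opp := opp C \<union> forced_fms F V G v, objs := dom_at F v\<rparr>"
      by (cases C) simp
  qed
  then have "?C \<in> R" using R C(1,2) tm unfolding winning_region_def by metis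
  then obtain C' where C': "C' \<in> R" "move Proponent G ?C C'" "to_move C' = Opponent"
    using R tm unfolding winning_region_def by metis
  then obtain S where S: "S \<subseteq> inst_fms G (dom_at F v)"
    "C' = \<lparr>opp = forced_fms F V G v, pro = pro C \<union> S, objs = dom_at F v\<rparr>"
    by (auto simp: move.simps)
  show ?thesis
    by (rule that[of v "pro C \<union> S"]) (use wv tm C' S pro v in auto)
qed

text \<open>Repeating \<open>opponent_step\<close> would descend forever in the well-founded
  relation of \<open>wf_forced_fms\<close>.\<close>

lemma no_winning_region_against_countermodel:
  assumes R: "winning_region G R" and M: "countermodel F K (\<lambda>c. c) V T {\<phi>}"
    and asc: "finite_ascents F" and G: "finite G" "G = T \<union> {\<phi>}" and K: "constants_of G \<subseteq> K"
    and closed: "\<forall>A\<in>T. fv A = {}" "fv \<phi> = {}"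
  shows "\<lparr>opp = T, pro = {\<phi>}, objs = constants_of G\<rparr> \<notin> R"
proof
  let ?C0 = "\<lparr>opp = T, pro = {\<phi>}, objs = constants_of G\<rparr>"
  assume C0: "?C0 \<in> R"
  have model: "kripke_model F K (\<lambda>c. c) V" using M by (simp add: countermodel_def)
  let ?f = "\<lambda>A w. forces F (\<lambda>c. c) V A w (\<lambda>_. undefined)"
  have no_state: False
    if "w \<in> worlds F" "\<lparr>opp = forced_fms F V G w, pro = P, objs = dom_at F w\<rparr> \<in> R"
      "to_move \<lparr>opp = forced_fms F V G w, pro = P, objs = dom_at F w\<rparr> = Opponent"
      "P \<subseteq> inst_fms G (dom_at F w)" "\<exists>B\<in>P. \<not> ?f B w" for w P
    using wf_forced_fms[OF model asc G(1)] that
  proof (induction w arbitrary: P rule: wf_induct_rule)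
    case (less w)
    from less.prems(5) obtain B where B: "B \<in> P" "\<not> ?f B w" by blast
    obtain v P' where v: "(w, v) \<in> acc F"
      "to_move \<lparr>opp = forced_fms F V G v, pro = P, objs = dom_at F v\<rparr> = Proponent"
      "\<lparr>opp = forced_fms F V G v, pro = P', objs = dom_at F v\<rparr> \<in> R"
      "to_move \<lparr>opp = forced_fms F V G v, pro = P', objs = dom_at F v\<rparr> = Opponent"
      "P' \<subseteq> inst_fms G (dom_at F v)" "\<exists>B\<in>P'. \<not> ?f B v"
      using opponent_step[OF R model asc G(1) less.prems(1,2,3), of B] B less.prems(4)
      by simp metis
    \<comment> \<open>If both components were equal, Opponent's move would have left the position
      unchanged, yet it was his turn before and is Proponent's turn after.\<close>
    have "(dom_at F v, forced_fms F V G v) \<noteq> (dom_at F w, forced_fms F V G w)"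
      using v(2) less.prems(3) by auto
    then show False
      using less.IH[of v P'] v kripke_frameD(4)[OF kripke_modelD(1)[OF model]] by blast
  qed
  obtain w e where w: "w \<in> worlds F" "\<not> forces F (\<lambda>c. c) V \<phi> w e"
    using M unfolding countermodel_def by blast
  then have \<phi>: "\<not> ?f \<phi> w" using closed(2) forces_cong[of \<phi> e "\<lambda>_. undefined" F] by auto
  have objs: "constants_of G \<subseteq> dom_at F w"
    using K kripke_modelD(2)[OF model _ w(1)] by blast
  have opp: "T \<subseteq> forced_fms F V G w"
    using M w(1) closed(1) G(2) by (auto simp: forced_fms_def countermodel_def intro!: closed_in_inst_fms)
  have \<phi>_inst: "\<phi> \<in> inst_fms G D" for D
    using closed(2) G(2) by (intro closed_in_inst_fms) auto
  \<comment> \<open>Proponent may be on turn at the start; his answer within \<open>R\<close> then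
    leads to a position of Opponent that still contains \<open>\<phi>\<close>.\<close>
  obtain C where C: "C \<in> R" "to_move C = Opponent" "objs C = constants_of G" "opp C = T"
    "pro C \<subseteq> inst_fms G (objs C)" "\<phi> \<in> pro C"
  proof (cases "to_move ?C0")
    case Opponent
    then show ?thesis using that[of ?C0] C0 \<phi>_inst by simp
  next
    case Proponent
    then obtain C where C: "C \<in> R" "move Proponent G ?C0 C" "to_move C = Opponent"
      using R C0 unfolding winning_region_def by metis
    then obtain S where "S \<subseteq> inst_fms G (constants_of G)" "C = ?C0\<lparr>pro := {\<phi>} \<union> S\<rparr>"
      by (auto simp: move.simps)
    then show ?thesis using that[of C] C \<phi>_inst by auto
  qed
  show False
    by (rule opponent_step[OF R model asc G(1) w(1) C(1,2) _ _ C(5,6) \<phi>])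
      (use objs opp C(3,4) no_state kripke_frameD(4)[OF kripke_modelD(1)[OF model]] in blast)+
qed

section \<open>Gluing countermodels under a new root\<close>

text \<open>Worlds are lists over the index type, with root \<open>[]\<close> and
  \<open>k # w\<close> for the world \<open>w\<close> of component \<open>k\<close>, so gluing stays
  within one type and can be iterated.\<close>

definition glued_frame :: "'d set \<Rightarrow> 'k set \<Rightarrow> ('k \<Rightarrow> ('k list, 'd) frame) \<Rightarrow> ('k list, 'd) frame" where
  "glued_frame D N M =
     \<lparr>worlds = insert [] {k # w | k w. k \<in> N \<and> w \<in> worlds (M k)},
      acc = {([], v) | v. v = [] \<or> (\<exists>k w. v = k # w \<and> k \<in> N \<and> w \<in> worlds (M k))} \<union>
            {(k # w, k # v) | k w v. k \<in> N \<and> (w, v) \<in> acc (M k)},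
      dom_at = (\<lambda>w. case w of [] \<Rightarrow> D | k # v \<Rightarrow> dom_at (M k) v)\<rparr>"

definition glued_val ::
  "('p \<Rightarrow> 'd list set) \<Rightarrow> ('k \<Rightarrow> 'k list \<Rightarrow> 'p \<Rightarrow> 'd list set) \<Rightarrow> 'k list \<Rightarrow> 'p \<Rightarrow> 'd list set" where
  "glued_val V0 V w = (case w of [] \<Rightarrow> V0 | k # v \<Rightarrow> V k v)"

lemma acc_glued_Cons:
  "(k # w, u) \<in> acc (glued_frame D N M) \<longleftrightarrow> (\<exists>v. u = k # v \<and> k \<in> N \<and> (w, v) \<in> acc (M k))"
  by (auto simp: glued_frame_def)

lemma acc_glued_Nil:
  "([], u) \<in> acc (glued_frame D N M) \<longleftrightarrow> u \<in> worlds (glued_frame D N M)"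
  by (auto simp: glued_frame_def)

text \<open>Forcing looks only at later worlds, and those of \<open>k # w\<close> form a copy of
  what lies above \<open>w\<close> in component \<open>k\<close>.\<close>

lemma forces_glued:
  "k \<in> N \<Longrightarrow> forces (glued_frame D N M) I (glued_val V0 V) A (k # w) e \<longleftrightarrow>
    forces (M k) I (V k) A w e"
  by (induction A arbitrary: w e) (auto simp: acc_glued_Cons, auto simp: glued_frame_def glued_val_def)

text \<open>Monotonicity from the root: each component interprets every element of \<open>D\<close>
  by itself, hence has it in all its domains, and satisfies the atoms of \<open>V0\<close>.\<close>

lemma kripke_model_glued:
  assumes M: "\<And>k. k \<in> N \<Longrightarrow> kripke_model (M k) D (\<lambda>c. c) (V k)"
    and V0: "\<And>p. V0 p \<subseteq> lists D" "\<And>k w p. k \<in> N \<Longrightarrow> w \<in> worlds (M k) \<Longrightarrow> V0 p \<subseteq> V k w p"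
  shows "kripke_model (glued_frame D N M) D (\<lambda>c. c) (glued_val V0 V)"
proof -
  let ?F = "glued_frame D N M"
  note F = kripke_frameD[OF kripke_modelD(1)[OF M]]
  have cases: "w = [] \<or> (\<exists>k v. w = k # v \<and> k \<in> N \<and> v \<in> worlds (M k))" if "w \<in> worlds ?F" for w
    using that by (auto simp: glued_frame_def)
  have "partial_order_on (worlds ?F) (acc ?F)"
    unfolding partial_order_on_def preorder_on_def
  proof (intro conjI)
    show sub: "acc ?F \<subseteq> worlds ?F \<times> worlds ?F" using F(4) by (fastforce simp: glued_frame_def)
    show "refl_on (worlds ?F) (acc ?F)" using F(1) by (auto simp: refl_on_def glued_frame_def)
    show "trans (acc ?F)"
    proof (rule transI)
      fix u v w assume uvw: "(u, v) \<in> acc ?F" "(v, w) \<in> acc ?F"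
      show "(u, w) \<in> acc ?F"
      proof (cases u)
        case Nil
        then show ?thesis using uvw(2) sub acc_glued_Nil by blast
      next
        case (Cons k u')
        then obtain v' w' where vw: "v = k # v'" "w = k # w'" "k \<in> N"
          "(u', v') \<in> acc (M k)" "(v', w') \<in> acc (M k)"
          using uvw by (auto simp: acc_glued_Cons)
        then show ?thesis using F(2)[OF vw(3,4,5)] Cons by (simp add: acc_glued_Cons)
      qed
    qed
    show "antisym (acc ?F)"
    proof (rule antisymI)
      fix u v assume "(u, v) \<in> acc ?F" "(v, u) \<in> acc ?F"
      then show "u = v" using F(3) by (cases u; cases v) (auto simp: acc_glued_Cons)
    qed
  qed
  moreover have dom: "dom_at ?F u \<subseteq> dom_at ?F v" and val: "glued_val V0 V u p \<subseteq> glued_val V0 V v p"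
    if uv: "(u, v) \<in> acc ?F" for u v p
  proof -
    consider "u = []" "v = []" | k w where "u = []" "v = k # w" "k \<in> N" "w \<in> worlds (M k)"
      | k w w' where "u = k # w" "v = k # w'" "k \<in> N" "(w, w') \<in> acc (M k)"
      using uv by (auto simp: glued_frame_def)
    then have "dom_at ?F u \<subseteq> dom_at ?F v \<and> glued_val V0 V u p \<subseteq> glued_val V0 V v p"
    proof cases
      case (2 k w)
      then show ?thesis
        using kripke_modelD(2)[OF M[OF 2(3)] _ 2(4)] V0(2)[OF 2(3,4)]
        by (simp add: glued_frame_def glued_val_def subset_iff)
    next
      case (3 k w w')
      then show ?thesis
        using F(5)[OF 3(3,4)] kripke_modelD(4)[OF M[OF 3(3)] 3(4)]
        by (simp add: glued_frame_def glued_val_def)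
    qed simp
    then show "dom_at ?F u \<subseteq> dom_at ?F v" "glued_val V0 V u p \<subseteq> glued_val V0 V v p" by auto
  qed
  ultimately have "kripke_frame ?F" unfolding kripke_frame_def by blast
  moreover have "c \<in> dom_at ?F w" if "c \<in> D" "w \<in> worlds ?F" for c w
    using cases[OF that(2)] that(1) kripke_modelD(2)[OF M] by (auto simp: glued_frame_def)
  moreover have "glued_val V0 V w p \<subseteq> lists (dom_at ?F w)" if "w \<in> worlds ?F" for w p
    using cases[OF that] kripke_modelD(3)[OF M] V0(1) by (fastforce simp: glued_frame_def glued_val_def)
  ultimately show ?thesis unfolding kripke_model_def using val by blast
qed

text \<open>A strictly ascending sequence has left the root by index 1 and then stays in one
  component.\<close>

lemma noetherian_glued:
  assumes "\<And>k. k \<in> N \<Longrightarrow> noetherian (M k)"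
  shows "noetherian (glued_frame D N M)"
  unfolding noetherian_iff
proof
  let ?F = "glued_frame D N M"
  assume "\<exists>f. ascending ?F f"
  then obtain f where f: "\<And>n. (f n, f (Suc n)) \<in> acc ?F" "\<And>n. f n \<noteq> f (Suc n)"
    unfolding ascending_def by blast
  have "f (Suc 0) \<noteq> []" using f[of 0] by (auto simp: glued_frame_def)
  then obtain k w where kw: "f (Suc 0) = k # w" by (cases "f (Suc 0)") auto
  have tail: "\<exists>v. f (Suc n) = k # v" for n
    by (induction n) (use kw f(1) acc_glued_Cons in \<open>metis+\<close>)
  then obtain g where g: "\<And>n. f (Suc n) = k # g n" by metis
  then have "(g n, g (Suc n)) \<in> acc (M k) \<and> k \<in> N \<and> g n \<noteq> g (Suc n)" for n
    using f[of "Suc n"] by (simp add: acc_glued_Cons)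
  then have "k \<in> N" "ascending (M k) g" unfolding ascending_def by blast+
  then show False using assms noetherian_iff by blast
qed

section \<open>Countermodels extracted from Opponent's wins\<close>

lemma closed_atom_in_inst_fms:
  assumes "Atom p ts \<in> inst_fms G D" and "constants_of G \<subseteq> D"
  obtains cs where "ts = map Con cs" and "cs \<in> lists D"
proof -
  have "\<exists>c\<in>D. t = Con c" if "t \<in> set ts" for t
  proof (cases t)
    case (Var x)
    then show ?thesis using that inst_fms_closed[OF assms(1)] by force
  next
    case (Con c)
    then show ?thesis using that inst_fms_consts[OF assms(1)] assms(2) by force
  qed
  then have "\<exists>cs\<in>lists D. ts = map Con cs"
  proof (induction ts)
    case (Cons t ts)
    obtain c where "c \<in> D" "t = Con c" using Cons.prems[of t] by auto
    moreover obtain cs where "cs \<in> lists D" "ts = map Con cs"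
      using Cons.IH Cons.prems by (metis list.set_intros(2))
    ultimately show ?case by (intro bexI[of _ "c # cs"]) auto
  qed simp
  then show ?thesis using that by blast
qed

text \<open>After a move of Opponent, a countermodel for the richer position also serves for the old
  one. All objects of the position are treated as constants of the model, so that
  \<open>objs C\<close> can be the domain of the root when gluing.\<close>

lemma opponent_wins_countermodel:
  fixes C :: "('p, 'c) position"
  assumes "opponent_wins G C" and "constants_of G \<subseteq> objs C"
    and "opp C \<subseteq> inst_fms G (objs C)" and "pro C \<subseteq> inst_fms G (objs C)"
  shows "\<exists>(F :: (('p, 'c) fm list, 'c) frame) V.
    noetherian F \<and> countermodel F (objs C) (\<lambda>c. c) V (opp C) (pro C)"
  using assms
proof induction
  case (opponent C C')
  from opponent.hyps(1,2) obtain D S where C': "objs C \<subseteq> D" "S \<subseteq> inst_fms G D"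
    "C' = C\<lparr>opp := opp C \<union> S, objs := D\<rparr>" by (auto simp: move.simps)
  have "inst_fms G (objs C) \<subseteq> inst_fms G D" by (rule inst_fms_mono[OF C'(1)])
  then have "opp C \<subseteq> inst_fms G D" "pro C \<subseteq> inst_fms G D" "constants_of G \<subseteq> D"
    using opponent.prems C'(1) by blast+
  then obtain F :: "(('p, 'c) fm list, 'c) frame" and V
    where "noetherian F" "countermodel F D (\<lambda>c. c) V (opp C \<union> S) (pro C)"
    using opponent.IH C' by auto
  moreover from this have "countermodel F (objs C) (\<lambda>c. c) V (opp C) (pro C)"
    using C'(1) unfolding countermodel_def kripke_model_def by blast
  ultimately show ?case by blast
next
  case (proponent C)
  let ?D = "objs C"
  \<comment> \<open>\<open>N\<close> collects the available formulas that can be refuted, each by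
    its own model, from \<open>opp C\<close>; the remaining ones, \<open>S\<close>, are what
    Proponent is made to add.\<close>
  define N where "N = {A \<in> inst_fms G ?D. \<exists>(F :: (('p, 'c) fm list, 'c) frame) V.
    noetherian F \<and> countermodel F ?D (\<lambda>c. c) V (opp C) {A}}"
  define S where "S = inst_fms G ?D - N"
  define C' where "C' = C\<lparr>pro := pro C \<union> S\<rparr>"
  show ?case
  proof (rule ccontr)
    assume none: "\<not> ?case"
    have "A \<notin> N" if "A \<in> pro C" for A
      using none that unfolding N_def countermodel_def by blast
    then have proS: "pro C \<subseteq> S" using proponent.prems(3) unfolding S_def by blast
    then have C': "C' = \<lparr>opp = opp C, pro = S, objs = ?D\<rparr>"
      unfolding C'_def by (cases C) auto
    have legal: "legal G C C'"
      unfolding C'_def proponent.hyps(1) move.simps S_def by blast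
    \<comment> \<open>If the move handed over the turn, the induction hypothesis would refute some
      formula of \<open>S\<close>, which would then belong to \<open>N\<close>.\<close>
    have "to_move C' \<noteq> Opponent"
    proof
      assume "to_move C' = Opponent"
      then obtain F :: "(('p, 'c) fm list, 'c) frame" and V
        where F: "noetherian F" "countermodel F ?D (\<lambda>c. c) V (opp C) S"
        using proponent.IH[OF legal] proponent.prems C' by (auto simp: S_def)
      then obtain A where "A \<in> S" "countermodel F ?D (\<lambda>c. c) V (opp C) {A}"
        unfolding countermodel_def by blast
      then show False using F(1) unfolding S_def N_def by blast
    qed
    then have "to_move C' = Proponent" by (cases "to_move C'") auto
    then have no_mistake: "\<And>A. A \<in> opp C \<Longrightarrow> holds C' A" and mistake: "\<exists>A\<in>S. \<not> holds C' A"
      by (auto simp: to_move_def C' split: if_splits)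
    \<comment> \<open>One countermodel is chosen for each formula of \<open>N\<close>, and the
      formula itself is the index of its component.\<close>
    have "\<forall>A\<in>N. \<exists>(F :: (('p, 'c) fm list, 'c) frame) V.
        noetherian F \<and> countermodel F ?D (\<lambda>c. c) V (opp C) {A}"
      by (simp add: N_def)
    then obtain M V where MV: "\<And>A. A \<in> N \<Longrightarrow> noetherian (M A :: (('p, 'c) fm list, 'c) frame) \<and>
        countermodel (M A) ?D (\<lambda>c. c) (V A) (opp C) {A}"
      by (metis bchoice)
    \<comment> \<open>At the root exactly the atoms asserted by Opponent hold.\<close>
    define V0 where "V0 p = {cs \<in> lists ?D. Atom p (map Con cs) \<in> opp C}" for p
    let ?F = "glued_frame ?D N M" and ?V = "glued_val V0 V"
    let ?f = "\<lambda>A w. forces ?F (\<lambda>c. c) ?V A w (\<lambda>_. undefined)"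
    have model: "kripke_model ?F ?D (\<lambda>c. c) ?V"
    proof (rule kripke_model_glued)
      show "kripke_model (M k) ?D (\<lambda>c. c) (V k)" if "k \<in> N" for k
        using MV[OF that] by (simp add: countermodel_def)
      show "V0 p \<subseteq> lists ?D" for p by (auto simp: V0_def)
      show "V0 p \<subseteq> V k w p" if "k \<in> N" "w \<in> worlds (M k)" for k w p
      proof
        fix cs assume "cs \<in> V0 p"
        then have "forces (M k) (\<lambda>c. c) (V k) (Atom p (map Con cs)) w undefined"
          using MV[OF that(1)] that(2) unfolding countermodel_def V0_def by blast
        then show "cs \<in> V k w p" by (simp add: comp_def)
      qed
    qed
    have noeth: "noetherian ?F" by (rule noetherian_glued) (use MV in blast)
    \<comment> \<open>A component refuting a formula of \<open>S\<close> would put that formula into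
      \<open>N\<close>, so all of \<open>opp C \<union> S\<close> holds above the root.\<close>
    have upper: "?f A (k # w)" if "A \<in> opp C \<union> S" "k \<in> N" "w \<in> worlds (M k)" for A k w
    proof -
      have k: "countermodel (M k) ?D (\<lambda>c. c) (V k) (opp C) {k}" "noetherian (M k)"
        using MV[OF that(2)] by auto
      have "forces (M k) (\<lambda>c. c) (V k) A w (\<lambda>_. undefined)"
      proof (cases "A \<in> opp C")
        case True
        then show ?thesis using k that(3) unfolding countermodel_def by blast
      next
        case False
        then have "A \<in> S" using that by blast
        then have "\<not> countermodel (M k) ?D (\<lambda>c. c) (V k) (opp C) {A}"
          using k(2) unfolding S_def N_def by blast
        then show ?thesis using k(1) that(3) unfolding countermodel_def by blast
      qed
      then show ?thesis by (simp add: forces_glued[OF that(2)])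
    qed
    have root: "[] \<in> worlds ?F" "dom_at ?F [] = ?D" by (simp_all add: glued_frame_def)
    have above: "u = [] \<or> (\<exists>k w. u = k # w \<and> k \<in> N \<and> w \<in> worlds (M k))"
      if "([], u) \<in> acc ?F" for u
      using that by (auto simp: glued_frame_def)
    have holds: "holds C' A \<longleftrightarrow> ?f A []" if "A \<in> inst_fms G ?D" for A
    proof (rule holds_iff_forces[OF kripke_modelD(1)[OF model] root(1)])
      show "objs C' = dom_at ?F []" using root C' by simp
      show "A \<in> inst_fms G (objs C')" using that C' by simp
      show "?f (Atom p ts) [] \<longleftrightarrow> Atom p ts \<in> opp C'"
        if "Atom p ts \<in> inst_fms G (objs C')" for p ts
      proof -
        have "Atom p ts \<in> inst_fms G ?D" using that C' by simp
        then obtain cs where "ts = map Con cs" "cs \<in> lists ?D"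
          using proponent.prems(1) by (rule closed_atom_in_inst_fms)
        then show ?thesis by (simp add: C' glued_val_def V0_def comp_def)
      qed
      \<comment> \<open>A formula of \<open>N\<close> is refuted in its own component, so by
        persistence it is not forced at the root; every other available formula lies in
        \<open>S\<close>.\<close>
      show "A \<in> opp C' \<union> pro C'" if "A \<in> inst_fms G (objs C')" "?f A []" for A
      proof (rule ccontr)
        assume "A \<notin> opp C' \<union> pro C'"
        then have A: "A \<in> N" using that(1) C' by (simp add: S_def)
        then obtain w e where w: "w \<in> worlds (M A)" "\<not> forces (M A) (\<lambda>c. c) (V A) A w e"
          using MV unfolding countermodel_def by blast
        have "([], A # w) \<in> acc ?F" using A w by (simp add: glued_frame_def)
        then have "?f A (A # w)" using forces_mono[OF model] that(2) by blast
        then have "forces (M A) (\<lambda>c. c) (V A) A w (\<lambda>_. undefined)" by (simp add: forces_glued[OF A])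
        then show False
          using w(2) forces_cong[of A "\<lambda>_. undefined" e "M A"] inst_fms_closed[OF that(1)] by auto
      qed
      show "?f (Imp A B) []"
        if "Imp A B \<in> opp C' \<union> pro C'" and at_root: "?f A [] \<Longrightarrow> ?f B []" for A B
      proof -
        have mem: "Imp A B \<in> opp C \<union> S" using that C' by simp
        have "?f B u" if u: "([], u) \<in> acc ?F" "?f A u" for u
        proof (cases "u = []")
          case False
          then obtain k w where "u = k # w" "k \<in> N" "w \<in> worlds (M k)" using above u by blast
          then have "?f (Imp A B) u" using upper[OF mem] by simp
          moreover have "(u, u) \<in> acc ?F"
            using kripke_frameD[OF kripke_modelD(1)[OF model]] u(1) by blast
          ultimately show ?thesis using u(2) by simp
        qed (use at_root u in simp)
        then show ?thesis by simp
      qed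
      show "?f (All x A) []"
        if "All x A \<in> opp C' \<union> pro C'"
          and at_root: "\<And>a. a \<in> dom_at ?F [] \<Longrightarrow> forces ?F (\<lambda>c. c) ?V A [] ((\<lambda>_. undefined)(x := a))" for x A
      proof -
        have mem: "All x A \<in> opp C \<union> S" using that C' by simp
        have "forces ?F (\<lambda>c. c) ?V A u ((\<lambda>_. undefined)(x := a))"
          if u: "([], u) \<in> acc ?F" "a \<in> dom_at ?F u" for u a
        proof (cases "u = []")
          case False
          then obtain k w where "u = k # w" "k \<in> N" "w \<in> worlds (M k)" using above u by blast
          then have "?f (All x A) u" using upper[OF mem] by simp
          moreover have "(u, u) \<in> acc ?F"
            using kripke_frameD[OF kripke_modelD(1)[OF model]] u(1) by blast
          ultimately show ?thesis using u(2) by simp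
        qed (use at_root u in simp)
        then show ?thesis by simp
      qed
    qed
    \<comment> \<open>Proponent's remaining mistake \<open>A\<close> fails at the root, while
      Opponent's formulas hold everywhere. The glued model thus refutes a formula of
      \<open>S\<close>, against the choice of \<open>S\<close>.\<close>
    obtain A where A: "A \<in> S" "\<not> holds C' A" using mistake by blast
    have AG: "A \<in> inst_fms G ?D" using A(1) by (simp add: S_def)
    have "forces ?F (\<lambda>c. c) ?V X w e" if "w \<in> worlds ?F" "X \<in> opp C" for X w e
    proof -
      have X: "X \<in> inst_fms G ?D" using that(2) proponent.prems(2) by blast
      then have "?f X []" using no_mistake[OF that(2)] holds by blast
      then have "?f X w" using forces_mono[OF model] that(1) acc_glued_Nil by blast
      then show ?thesis using forces_cong[of X e "\<lambda>_. undefined" ?F] inst_fms_closed[OF X] by auto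
    qed
    then have "countermodel ?F ?D (\<lambda>c. c) ?V (opp C) {A}"
      using model A(2) holds[OF AG] root(1) unfolding countermodel_def by blast
    then show False using A(1) noeth unfolding S_def N_def by blast
  qed
qed

section \<open>Winning strategies and consequence over Casari frames\<close>

theorem theorem2:
  fixes \<O>\<^sub>0 \<Gamma> :: "('p, 'c) fm set" and \<phi> :: "('p, 'c) fm" and \<Delta>\<^sub>0 :: "'c set"
  assumes "infinite (UNIV :: 'c set)"
    and "infinite (UNIV :: 'w set)"
    and "infinite (UNIV :: 'd set)"
    and "finite \<O>\<^sub>0"
    and "\<forall>\<psi>\<in>\<O>\<^sub>0. closed_fm \<psi>"
    and "closed_fm \<phi>"
    and "\<Gamma> = \<O>\<^sub>0 \<union> {\<phi>}"
    and "\<Delta>\<^sub>0 = constants_of \<Gamma>"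
  shows "proponent_has_winning_strategy \<Gamma> \<lparr>opp = \<O>\<^sub>0, pro = {\<phi>}, objs = \<Delta>\<^sub>0\<rparr>
           \<longleftrightarrow> consequence (Cas :: ('w, 'd) frame set) \<O>\<^sub>0 \<phi>"
proof
  have closed: "\<forall>A\<in>\<O>\<^sub>0. fv A = {}" "fv \<phi> = {}"
    using assms(5,6) by (auto simp: closed_fm_def)
  note not_consequence = not_consequence_iff[OF closed, folded assms(7), folded assms(8)]
  let ?C0 = "\<lparr>opp = \<O>\<^sub>0, pro = {\<phi>}, objs = \<Delta>\<^sub>0\<rparr>"
  show "consequence (Cas :: ('w, 'd) frame set) \<O>\<^sub>0 \<phi>"
    if win: "proponent_has_winning_strategy \<Gamma> ?C0"
  proof (rule ccontr)
    assume "\<not> consequence (Cas :: ('w, 'd) frame set) \<O>\<^sub>0 \<phi>"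
    then obtain F :: "('w, 'd) frame" and I V
      where F: "F \<in> Cas" "countermodel F \<Delta>\<^sub>0 I V \<O>\<^sub>0 {\<phi>}"
      unfolding not_consequence by blast
    \<comment> \<open>The model has to live on objects of the game before Opponent can play
      it.\<close>
    obtain F' :: "('w, 'c) frame" and V'
      where F': "countermodel F' \<Delta>\<^sub>0 (\<lambda>c. c) V' \<O>\<^sub>0 {\<phi>}" "finite_ascents F'"
      using countermodel_over_constants[OF F(2) Cas_finite_ascents[OF F(1)] assms(4) closed _ assms(1)]
        assms(7,8) by metis
    obtain R where "winning_region \<Gamma> R" "?C0 \<in> R"
      using win winning_strategy_imp_region unfolding proponent_has_winning_strategy_def by metis
    then show False
      using no_winning_region_against_countermodel[OF _ F' _ assms(7) _ closed, of R] assms(4,7,8)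
      by simp
  qed
  show "proponent_has_winning_strategy \<Gamma> ?C0"
    if cons: "consequence (Cas :: ('w, 'd) frame set) \<O>\<^sub>0 \<phi>"
  proof (rule ccontr)
    assume "\<not> proponent_has_winning_strategy \<Gamma> ?C0"
    then have "opponent_wins \<Gamma> ?C0" using opponent_wins_or_proponent_strategy by blast
    moreover have "\<O>\<^sub>0 \<subseteq> inst_fms \<Gamma> \<Delta>\<^sub>0" "{\<phi>} \<subseteq> inst_fms \<Gamma> \<Delta>\<^sub>0"
      using closed assms(7) by (auto intro: closed_in_inst_fms)
    ultimately obtain F :: "(('p, 'c) fm list, 'c) frame" and V
      where F: "noetherian F" "countermodel F \<Delta>\<^sub>0 (\<lambda>c. c) V \<O>\<^sub>0 {\<phi>}"
      using opponent_wins_countermodel[of \<Gamma> ?C0] assms(8) by auto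
    \<comment> \<open>The extracted countermodel has lists of formulas as worlds and objects as
      individuals; it is moved to the types over which \<open>Cas\<close> is taken.\<close>
    obtain F' :: "('w, 'd) frame" and I' V'
      where F': "countermodel F' \<Delta>\<^sub>0 I' V' \<O>\<^sub>0 {\<phi>}" "noetherian F'"
      using countermodel_transfer[OF F(2,1) assms(4) closed _ assms(2,3)] assms(7,8) by metis
    have "F' \<in> Cas"
      using F' noetherian_Cas by (auto simp: countermodel_def kripke_model_def)
    then show False using cons F'(1) not_consequence by blast
  qed
qed

end
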